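(* In the setting and notation described in the context, the perturbed mixed multiple orthogonality for the matrix of measures $\mathrm d\hat\mu=\mathrm d\mu\,R$ exists if and only if $\tau_n\neq0$ for all $n\in\mathbb N_0$.
   Context: Original orthogonality. Let $p,q,N\ge1$ be integers and $r\in\{0,\dots,p-1\}$. Let $\mathrm d\mu=(\mathrm d\mu_{b,a})$ be a $q\times p$ matrix of measures supported on $\Delta\subseteq\mathbb R$, with all moments finite. For $s\in\mathbb N$ let $X_{[s]}(x)$ be the semi-infinite matrix obtained by stacking $I_s,xI_s,x^2I_s,\dots$ vertically. The moment matrix is $\mathscr M=\int_\Delta X_{[q]}(x)\,\mathrm d\mu(x)\,X_{[p]}^\top(x)$. It is assumed that all leading principal submatrices of $\mathscr M$ are nonsingular, so there is a unique Gauss--Borel factorization $\mathscr M=S^{-1}H\bar S^{-\top}$ with $S,\bar S$ lower unitriangular and $H$ nonsingular diagonal (semi-infinite matrices, rows and columns indexed from $0$). Put $A(x)=X_{[p]}^\top(x)\bar S^\top H^{-1}$, a $p\times\infty$ matrix of polynomials, whose column number $n\in\mathbb N_0$ is denoted $A_n(x)=\big(A_n^{(1)}(x),\dots,A_n^{(p)}(x)\big)^\top$. Perturbation. $R(x)=\sum_{l=0}^N R_lx^l$, $R_l\in\mathbb C^{p\times p}$, with $$R_N=\begin{bmatrix}0_{(p-r)\times r}&I_{p-r}\\0_{r\times r}&0_{r\times(p-r)}\end{bmatrix},\qquad R_{N-1}=\begin{bmatrix}R^1_{N-1}&R^2_{N-1}\\ I_r&R^4_{N-1}\end{bmatrix},$$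 the blocks of $R_{N-1}$ having the same sizes as those of $R_N$ and $R^1_{N-1},R^2_{N-1},R^4_{N-1}$ arbitrary. Then $\det R(x)$ has degree $Np-r$. Set $\mathrm d\hat\mu(x)=\mathrm d\mu(x)R(x)$ and $\hat{\mathscr M}=\int_\Delta X_{[q]}(x)\,\mathrm d\hat\mu(x)\,X_{[p]}^\top(x)$. "The perturbed mixed multiple orthogonality exists" means that $\hat{\mathscr M}$ admits a Gauss--Borel factorization $\hat{\mathscr M}=\hat S^{-1}\hat H\hat{\bar S}^{-\top}$ with $\hat S,\hat{\bar S}$ lower unitriangular and $\hat H$ nonsingular diagonal (equivalently, all its leading principal submatrices are nonsingular), so that the perturbed mixed multiple orthogonal polynomials $\hat B=\hat SX_{[q]}$, $\hat A=X_{[p]}^\top\hat{\bar S}^\top\hat H^{-1}$ are defined. Jordan chains. A (left) Jordan chain of length $\kappa$ of $R(x)$ at $x_0\in\mathbb C$ is a list of row vectors $\boldsymbol v_0\ne0,\boldsymbol v_1,\dots,\boldsymbol v_{\kappa-1}$ in $\mathbb C^p$ with $\sum_{l=0}^i\frac1{l!}\boldsymbol v_{i-l}R^{(l)}(x_0)=0$ for $i=0,\dots,\kappa-1$, where $R^{(l)}$ is the $l$-th derivative. If $x_0$ is a zero of $\det R$ of multiplicity $K$, a canonical set of Jordan chains at $x_0$ is a family of $s\le p$ Jordan chains $\boldsymbol v_{j,0},\dots,\boldsymbol v_{j,\kappa_j-1}$ ($j=1,\dots,s$) at $x_0$ such that $\sum_j\kappa_j=K$ and $\boldsymbol v_{1,0},\dots,\boldsymbol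 v_{s,0}$ are linearly independent. $\tau$ determinants. Let $x_1,\dots,x_M$ be the distinct zeros of $\det R$, with multiplicities $K_1,\dots,K_M$ (so $\sum_iK_i=Np-r$), and fix a canonical set of Jordan chains at each $x_i$, with $s_i$ chains $\boldsymbol v_{j,0},\dots,\boldsymbol v_{j,\kappa_{i,j}-1}$ of lengths $\kappa_{i,j}$ (dependence on $i$ omitted). Let $\mathbb A_n(x_i)\in\mathbb C^{K_i}$ be the column vector with entries, for $j=1,\dots,s_i$ and $k=0,\dots,\kappa_{i,j}-1$ in order, $\sum_{l=0}^k\frac1{l!}\boldsymbol v_{j,k-l}\frac{\mathrm d^lA_n}{\mathrm dx^l}(x_i)$ (if all zeros are simple, this is just the scalar $\boldsymbol v_iA_n(x_i)$ with $\boldsymbol v_i\ne0$, $\boldsymbol v_iR(x_i)=0$). Then $\tau_n$ is the determinant of the $(Np-r)\times(Np-r)$ matrix whose columns, for $j=0,\dots,Np-r-1$, are obtained by stacking $\mathbb A_{n+j}(x_1),\dots,\mathbb A_{n+j}(x_M)$. *)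

theory Defs
  imports "HOL-Analysis.Bochner_Integration" "HOL-Library.Groups_Big_Fun"
    "Jordan_Normal_Form.VS_Connect"
begin

hide_const (open) Finite_Cartesian_Product.vec Finite_Cartesian_Product.row
  Finite_Cartesian_Product.column

no_notation Finite_Cartesian_Product.vec_nth (infixl \<open>$\<close> 90)
no_notation Inner_Product.real_inner_class.inner (infix \<open>\<bullet>\<close> 70)

type_synonym 'a smat = "nat \<Rightarrow> nat \<Rightarrow> 'a"

text \<open>
  The entries of a product are sums over all natural numbers. They have finite support, and are
  thus given by \<open>Sum_any\<close>, whenever the left factor has finite rows or the right factor has finite
  columns, which is the case in the Gauss-Borel factorization and in the definition of \<open>A\<close>.
\<close>

definition smat_times :: "complex smat \<Rightarrow> complex smat \<Rightarrow> complex smat"  (infixl \<open>\<star>\<close> 70)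
  where "A \<star> B = (\<lambda>i j. Sum_any (\<lambda>k. A i k * B k j))"

definition smat_one :: "complex smat"
  where "smat_one = (\<lambda>i j. if i = j then 1 else 0)"

definition smat_transpose :: "complex smat \<Rightarrow> complex smat"
  where "smat_transpose A = (\<lambda>i j. A j i)"

text \<open>
  The inverse is used only for lower triangular matrices with nonzero diagonal entries. Such an \<open>A\<close>
  has exactly one right inverse in this sense; it is lower triangular and also a left inverse.
\<close>

definition smat_inverse :: "complex smat \<Rightarrow> complex smat"
  where "smat_inverse A = (THE B. A \<star> B = smat_one \<and> B \<star> A = smat_one)"

definition lower_unitriangular :: "complex smat \<Rightarrow> bool"
  where "lower_unitriangular A \<longleftrightarrow> (\<forall>i. A i i = 1) \<and> (\<forall>i j. i < j \<longrightarrow> A i j = 0)"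

definition nonsingular_diagonal :: "complex smat \<Rightarrow> bool"
  where "nonsingular_diagonal A \<longleftrightarrow> (\<forall>i. A i i \<noteq> 0) \<and> (\<forall>i j. i \<noteq> j \<longrightarrow> A i j = 0)"

definition leading_submatrix :: "complex smat \<Rightarrow> nat \<Rightarrow> complex mat"
  where "leading_submatrix A n = mat n n (\<lambda>(i, j). A i j)"

definition gauss_borel :: "complex smat \<Rightarrow> complex smat \<Rightarrow> complex smat \<Rightarrow> complex smat \<Rightarrow> bool"
  where "gauss_borel M S H Sb \<longleftrightarrow>
    lower_unitriangular S \<and> nonsingular_diagonal H \<and> lower_unitriangular Sb \<and>
    M = smat_inverse S \<star> H \<star> smat_transpose (smat_inverse Sb)"

text \<open>
  A \<open>q \<times> p\<close> matrix of (complex Borel) measures on \<open>\<Delta>\<close> is given as \<open>W d\<nu>\<close>, where \<open>\<nu>\<close> is a positive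
  Borel measure on \<open>\<Delta>\<close> and \<open>W\<close> is a \<open>q \<times> p\<close> matrix of complex densities: the entry \<open>(b, a)\<close> is the
  measure mapping \<open>E\<close> to the integral of \<open>W\<^sub>b\<^sub>a\<close> over \<open>E\<close> with respect to \<open>\<nu>\<close>. By the
  Radon-Nikodym theorem this covers every matrix of finite complex, signed or positive
  measures (take for \<open>\<nu>\<close> the sum of the total variations of the entries). Multiplying the matrix of
  measures by a matrix function on the right amounts to multiplying \<open>W\<close> by it. The integrability
  clause says that all absolute moments of all entries are finite.
\<close>

definition matrix_of_measures ::
    "nat \<Rightarrow> nat \<Rightarrow> real set \<Rightarrow> real measure \<Rightarrow> (real \<Rightarrow> complex mat) \<Rightarrow> bool"
  where "matrix_of_measures q p \<Delta> \<nu> W \<longleftrightarrow>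
    sets \<nu> = sets (restrict_space borel \<Delta>) \<and>
    (\<forall>x\<in>\<Delta>. W x \<in> carrier_mat q p) \<and>
    (\<forall>b<q. \<forall>a<p. \<forall>k. integrable \<nu> (\<lambda>x. complex_of_real x ^ k * W x $$ (b, a)))"

text \<open>The semi-infinite stack of \<open>I\<^sub>s, x I\<^sub>s, x\<^sup>2 I\<^sub>s, \<dots>\<close>, as a matrix with \<open>s\<close> columns.\<close>

definition X_stack :: "nat \<Rightarrow> nat \<Rightarrow> nat \<Rightarrow> complex poly"
  where "X_stack s i a = (if i mod s = a then monom 1 (i div s) else 0)"

definition moment_matrix ::
    "nat \<Rightarrow> nat \<Rightarrow> real measure \<Rightarrow> (real \<Rightarrow> complex mat) \<Rightarrow> complex smat"
  where "moment_matrix q p \<nu> W = (\<lambda>i j. LINT x|\<nu>.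
    (\<Sum>b<q. \<Sum>a<p. poly (X_stack q i b) (complex_of_real x) * W x $$ (b, a) *
                   poly (X_stack p j a) (complex_of_real x)))"

text \<open>The column \<open>A\<^sub>n\<close> of \<open>A = X\<^sub>p\<^sup>T Sb\<^sup>T H\<^sup>-\<^sup>1\<close>, a vector of \<open>p\<close> polynomials.\<close>

definition A_poly :: "nat \<Rightarrow> complex smat \<Rightarrow> complex smat \<Rightarrow> nat \<Rightarrow> complex poly vec"
  where "A_poly p H Sb n = vec p (\<lambda>a.
    Sum_any (\<lambda>k. Polynomial.smult ((smat_transpose Sb \<star> smat_inverse H) k n) (X_stack p k a)))"

definition matrix_poly :: "nat \<Rightarrow> nat \<Rightarrow> (nat \<Rightarrow> complex mat) \<Rightarrow> complex poly mat"
  where "matrix_poly p N R = mat p p (\<lambda>(i, j). \<Sum>l\<le>N. monom (R l $$ (i, j)) l)"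

definition eval_mat :: "complex poly mat \<Rightarrow> complex \<Rightarrow> complex mat"
  where "eval_mat P z = map_mat (\<lambda>f. poly f z) P"

definition perturbed_density ::
    "(real \<Rightarrow> complex mat) \<Rightarrow> complex poly mat \<Rightarrow> real \<Rightarrow> complex mat"
  where "perturbed_density W P = (\<lambda>x. W x * eval_mat P (complex_of_real x))"

definition perturbed_orthogonality_exists ::
    "nat \<Rightarrow> nat \<Rightarrow> real measure \<Rightarrow> (real \<Rightarrow> complex mat) \<Rightarrow> complex poly mat \<Rightarrow> bool"
  where "perturbed_orthogonality_exists q p \<nu> W P \<longleftrightarrow>
    (\<exists>S H Sb. gauss_borel (moment_matrix q p \<nu> (perturbed_density W P)) S H Sb)"

definition deriv_mat_at :: "complex poly mat \<Rightarrow> nat \<Rightarrow> complex \<Rightarrow> complex mat"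
  where "deriv_mat_at P l z = map_mat (\<lambda>f. poly ((pderiv ^^ l) f) z) P"

definition deriv_vec_at :: "complex poly vec \<Rightarrow> nat \<Rightarrow> complex \<Rightarrow> complex vec"
  where "deriv_vec_at u l z = map_vec (\<lambda>f. poly ((pderiv ^^ l) f) z) u"

text \<open>
  In \<open>jordan_chain\<close> the entry \<open>c\<close> of the row vector \<open>v D\<close> is written \<open>v \<bullet> col D c\<close>. The operation
  \<open>\<bullet>\<close> on vectors is bilinear: no complex conjugation is involved.
\<close>

definition jordan_chain :: "nat \<Rightarrow> complex poly mat \<Rightarrow> complex \<Rightarrow> complex vec list \<Rightarrow> bool"
  where "jordan_chain p P z v \<longleftrightarrow>
    v \<noteq> [] \<and> set v \<subseteq> carrier_vec p \<and> v ! 0 \<noteq> 0\<^sub>v p \<and>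
    (\<forall>i<length v. \<forall>c<p. (\<Sum>l\<le>i. 1 / fact l * (v ! (i - l) \<bullet> col (deriv_mat_at P l z) c)) = 0)"

definition canonical_jordan_chains ::
    "nat \<Rightarrow> complex poly mat \<Rightarrow> complex \<Rightarrow> complex vec list list \<Rightarrow> bool"
  where "canonical_jordan_chains p P z C \<longleftrightarrow>
    length C \<le> p \<and>
    (\<forall>v\<in>set C. jordan_chain p P z v) \<and>
    sum_list (map length C) = Polynomial.order z (det P) \<and>
    distinct (map (\<lambda>v. v ! 0) C) \<and>
    \<not> LinearCombinations.module.lin_dep class_ring (module_vec TYPE(complex) p)
        (set (map (\<lambda>v. v ! 0) C))"

text \<open>The column vectors are represented by lists of their entries, stacking is concatenation.\<close>

definition spectral_entries ::
    "complex poly vec \<Rightarrow> complex \<Rightarrow> complex vec list list \<Rightarrow> complex list"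
  where "spectral_entries u z C = concat (map (\<lambda>v.
    map (\<lambda>k. \<Sum>l\<le>k. 1 / fact l * (v ! (k - l) \<bullet> deriv_vec_at u l z)) [0..<length v]) C)"

definition tau ::
    "nat \<Rightarrow> (nat \<Rightarrow> complex poly vec) \<Rightarrow> complex list \<Rightarrow> (nat \<Rightarrow> complex vec list list) \<Rightarrow> nat \<Rightarrow> complex"
  where "tau d A xs C n = det (mat_of_cols d (map (\<lambda>j.
    vec_of_list (concat (map (\<lambda>i. spectral_entries (A (n + j)) (xs ! i) (C i)) [0..<length xs])))
    [0..<d]))"

end

theory Submission
  imports Defs "HOL-Computational_Algebra.Fundamental_Theorem_Algebra"
begin

text \<open>
  Let \<open>d = Np - r\<close> and let \<open>X\<^sub>j\<close> be the columns of \<open>X\<^sub>p\<^sup>T\<close>, a basis of the polynomial vectors. The shape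
  of the two leading coefficients means that \<open>R X\<^sub>j\<close> is \<open>X\<^sub>j\<^sub>+\<^sub>d\<close> plus a combination of earlier basis
  vectors, so the perturbed moment matrix is \<open>M L\<close>, where \<open>L\<close> is a matrix with ones on the \<open>d\<close>-th
  subdiagonal and zeros below it. The \<open>d\<close> functionals given by the Jordan chains annihilate all
  multiples \<open>R g\<close>; they are linearly independent, because the first vectors of the chains at each
  zero are. Let \<open>F\<close> be the matrix of the functionals in the basis \<open>X\<^sub>j\<close>, so that \<open>F L = 0\<close>. Stacking \<open>n\<close>
  rows of \<open>M\<close> on \<open>F\<close> and truncating to \<open>n + d\<close> columns gives a square matrix. Its determinant is, up to
  nonzero factors, the \<open>n\<close>-th minor of \<open>M L\<close> on the one hand and, by the orthogonality of the \<open>A\<^sub>n\<close>,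
  \<open>\<tau>\<^sub>n\<close> on the other.
\<close>

section \<open>Triangular semi-infinite matrices and Gauss-Borel factorizations\<close>

definition lower_triangular_smat :: "complex smat \<Rightarrow> bool"
  where "lower_triangular_smat A \<longleftrightarrow> (\<forall>i j. i < j \<longrightarrow> A i j = 0)"

text \<open>\<open>Sum_any\<close> ranges over the support only, so a finite range containing the
  support gives the same value. All later computations with entries of products start from such a
  truncation.\<close>

lemma smat_times_eq_sum:
  assumes "\<And>k. k \<ge> n \<Longrightarrow> A i k * B k j = 0"
  shows "(A \<star> B) i j = (\<Sum>k<n. A i k * B k j)"
  unfolding smat_times_def
  by (rule Sum_any.expand_superset) (use assms not_le in auto)

lemma smat_times_lower:
  assumes "lower_triangular_smat A" and "i < n"
  shows "(A \<star> B) i j = (\<Sum>k<n. A i k * B k j)"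
  by (rule smat_times_eq_sum) (use assms in \<open>auto simp: lower_triangular_smat_def\<close>)

lemma smat_times_upper:
  assumes "lower_triangular_smat (smat_transpose B)" and "j < n"
  shows "(A \<star> B) i j = (\<Sum>k<n. A i k * B k j)"
  by (rule smat_times_eq_sum)
    (use assms in \<open>auto simp: lower_triangular_smat_def smat_transpose_def\<close>)

lemma smat_transpose_transpose [simp]: "smat_transpose (smat_transpose A) = A"
  by (simp add: smat_transpose_def)

lemma smat_transpose_times: "smat_transpose (A \<star> B) = smat_transpose B \<star> smat_transpose A"
  by (simp add: smat_transpose_def smat_times_def mult.commute)

lemma smat_transpose_one [simp]: "smat_transpose smat_one = smat_one"
  by (intro ext) (simp add: smat_transpose_def smat_one_def)

lemma lower_triangular_smat_times:
  assumes "lower_triangular_smat A" and "lower_triangular_smat B"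
  shows "lower_triangular_smat (A \<star> B)" and "(A \<star> B) i i = A i i * B i i"
proof -
  have "A i k * B k j = 0" if "i < j" for i j k
    using that assms by (cases "i < k") (auto simp: lower_triangular_smat_def)
  then show "lower_triangular_smat (A \<star> B)"
    unfolding lower_triangular_smat_def
    by (intro allI impI, subst smat_times_eq_sum[of 0]) simp_all
  have "(A \<star> B) i i = (\<Sum>k<Suc i. A i k * B k i)"
    by (rule smat_times_lower[OF assms(1)]) simp
  also have "\<dots> = A i i * B i i"
    using assms(2) by (auto simp: lower_triangular_smat_def intro!: sum.neutral)
  finally show "(A \<star> B) i i = A i i * B i i" .
qed

lemma smat_times_one_left [simp]: "smat_one \<star> A = A"
proof (intro ext)
  fix i j
  have "(smat_one \<star> A) i j = (\<Sum>k<Suc i. smat_one i k * A k j)"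
    by (rule smat_times_lower) (auto simp: lower_triangular_smat_def smat_one_def)
  then show "(smat_one \<star> A) i j = A i j"
    by (auto simp: smat_one_def intro!: sum.neutral)
qed

lemma smat_times_one_right [simp]: "A \<star> smat_one = A"
  using smat_transpose_times[of A smat_one] by (metis smat_times_one_left smat_transpose_one
      smat_transpose_transpose)

text \<open>For a fixed row \<open>i\<close>, triangularity of the two left factors confines both
  inner indices to values up to \<open>i\<close>, so the iterated sums are finite and can be
  exchanged whatever \<open>C\<close> is.\<close>

lemma smat_times_assoc_lower:
  assumes "lower_triangular_smat A" and "lower_triangular_smat B"
  shows "A \<star> B \<star> C = A \<star> (B \<star> C)"
proof (intro ext)
  fix i j
  have "(A \<star> B \<star> C) i j = (\<Sum>k<Suc i. (\<Sum>l<Suc i. A i l * B l k) * C k j)"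
    by (subst smat_times_lower[OF lower_triangular_smat_times(1)[OF assms] lessI],
        subst smat_times_lower[OF assms(1) lessI]) simp
  also have "\<dots> = (\<Sum>l<Suc i. A i l * (\<Sum>k<Suc i. B l k * C k j))"
    unfolding sum_distrib_left sum_distrib_right
    by (subst sum.swap) (simp only: mult.assoc)
  also have "\<dots> = (A \<star> (B \<star> C)) i j"
    by (subst smat_times_lower[OF assms(1) lessI], intro sum.cong refl)
      (subst smat_times_lower[OF assms(2)], auto)
  finally show "(A \<star> B \<star> C) i j = (A \<star> (B \<star> C)) i j" .
qed

text \<open>Transposition reverses products and reduces this to the lower triangular case.\<close>

lemma smat_times_assoc_upper:
  assumes "lower_triangular_smat (smat_transpose B)" and "lower_triangular_smat (smat_transpose C)"
  shows "A \<star> B \<star> C = A \<star> (B \<star> C)"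
  using smat_times_assoc_lower[OF assms(2,1), of "smat_transpose A"]
  by (metis smat_transpose_times smat_transpose_transpose)

section \<open>Inversion of triangular matrices by forward substitution\<close>

context
  fixes A :: "complex smat"
begin

text \<open>Shows the function package that the recursive calls inside the sum occur only at indices
  \<open>k < i\<close>, as termination needs.\<close>

private lemma sum_cong_fundef [fundef_cong]:
  "(I :: nat set) = J \<Longrightarrow> (\<And>x. x \<in> J \<Longrightarrow> g x = h x) \<Longrightarrow> sum g I = (sum h J :: complex)"
  by (rule sum.cong)

text \<open>Column \<open>j\<close> solves \<open>A x = e_j\<close> from the top down: row
  \<open>i\<close> determines the unknown \<open>x_i\<close> from those with smaller index, provided
  that the diagonal entry is nonzero.\<close>

fun forward_substitution :: "complex smat" where
  "forward_substitution i j =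
    (smat_one i j - (\<Sum>k<i. A i k * forward_substitution k j)) / A i i"

end

declare forward_substitution.simps [simp del]

lemma lower_triangular_forward_substitution:
  "lower_triangular_smat (forward_substitution A)"
proof -
  have "i < j \<longrightarrow> forward_substitution A i j = 0" for i j
    by (induction i rule: less_induct) (subst forward_substitution.simps, simp add: smat_one_def)
  then show ?thesis by (simp add: lower_triangular_smat_def)
qed

lemma forward_substitution_diagonal: "forward_substitution A i i = 1 / A i i"
  using lower_triangular_forward_substitution[of A]
  by (subst forward_substitution.simps) (simp add: lower_triangular_smat_def smat_one_def)

lemma times_forward_substitution:
  assumes "lower_triangular_smat A" and "\<And>i. A i i \<noteq> 0"
  shows "A \<star> forward_substitution A = smat_one"
proof (intro ext)
  fix i j
  have "(A \<star> forward_substitution A) i j = (\<Sum>k<Suc i. A i k * forward_substitution A k j)"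
    by (rule smat_times_lower[OF assms(1) lessI])
  also have "\<dots> = smat_one i j"
    using assms(2) by (subst sum.lessThan_Suc, subst (2) forward_substitution.simps) simp
  finally show "(A \<star> forward_substitution A) i j = smat_one i j" .
qed

text \<open>The right inverse \<open>B\<close> of \<open>A\<close> is again lower triangular with
  nonzero diagonal, so it has a right inverse \<open>B'\<close> of its own. Associativity gives
  \<open>A = A (B B') = (A B) B' = B'\<close>, hence \<open>B A = 1\<close>.\<close>

lemma forward_substitution_times:
  assumes "lower_triangular_smat A" and "\<And>i. A i i \<noteq> 0"
  shows "forward_substitution A \<star> A = smat_one"
proof -
  define B where "B = forward_substitution A"
  have B: "lower_triangular_smat B" "\<And>i. B i i \<noteq> 0"
    using lower_triangular_forward_substitution forward_substitution_diagonal assms(2)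
    by (auto simp: B_def)
  have "A = A \<star> (B \<star> forward_substitution B)"
    by (simp add: times_forward_substitution[OF B])
  also have "\<dots> = A \<star> B \<star> forward_substitution B"
    by (rule smat_times_assoc_lower[OF assms(1) B(1), symmetric])
  also have "\<dots> = forward_substitution B"
    by (simp add: B_def times_forward_substitution[OF assms])
  finally show ?thesis
    using times_forward_substitution[OF B] by (simp add: B_def)
qed

text \<open>A right inverse suffices, and it may have any shape: multiplication by the triangular
  inverse on the left is associative here and forces \<open>B\<close> to be the result of forward
  substitution. This gives \<open>THE\<close> its unique value.\<close>

lemma smat_inverse_unique:
  assumes "lower_triangular_smat A" and "\<And>i. A i i \<noteq> 0" and "A \<star> B = smat_one"
  shows "smat_inverse A = B"
proof -
  note inv = times_forward_substitution[OF assms(1,2)] forward_substitution_times[OF assms(1,2)]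
  have unique: "B' = forward_substitution A" if "A \<star> B' = smat_one" for B'
    using smat_times_assoc_lower[OF lower_triangular_forward_substitution assms(1), of A B'] that inv
    by simp
  show ?thesis
    unfolding smat_inverse_def
  proof (rule the_equality)
    show "A \<star> B = smat_one \<and> B \<star> A = smat_one"
      using unique[OF assms(3)] inv by simp
  qed (use unique assms(3) in metis)
qed

lemma smat_inverse_lower:
  assumes "lower_triangular_smat A" and "\<And>i. A i i \<noteq> 0"
  shows "A \<star> smat_inverse A = smat_one" and "smat_inverse A \<star> A = smat_one"
    and "lower_triangular_smat (smat_inverse A)" and "smat_inverse A i i = 1 / A i i"
  using times_forward_substitution[OF assms] forward_substitution_times[OF assms]
    lower_triangular_forward_substitution[of A] forward_substitution_diagonal[of A]
    smat_inverse_unique[OF assms]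
  by auto

lemma lower_unitriangularD:
  assumes "lower_unitriangular A"
  shows "lower_triangular_smat A" and "A i i = 1"
  using assms by (auto simp: lower_unitriangular_def lower_triangular_smat_def)

lemma smat_inverse_unitriangular:
  assumes "lower_unitriangular A"
  shows "A \<star> smat_inverse A = smat_one" and "smat_inverse A \<star> A = smat_one"
    and "lower_unitriangular (smat_inverse A)"
  using smat_inverse_lower[OF lower_unitriangularD(1)[OF assms]] lower_unitriangularD(2)[OF assms]
  by (auto simp: lower_unitriangular_def lower_triangular_smat_def)

text \<open>The factorization is stated through \<open>smat_inverse S\<close>, whereas its
  construction yields that factor directly; \<open>S\<close> is then recovered as the
  inverse.\<close>

lemma smat_inverse_smat_inverse:
  assumes "lower_unitriangular A"
  shows "smat_inverse (smat_inverse A) = A"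
proof (rule smat_inverse_unique)
  show "lower_triangular_smat (smat_inverse A)" "smat_inverse A i i \<noteq> 0" for i
    using lower_unitriangularD[OF smat_inverse_unitriangular(3)[OF assms]] by simp_all
qed (rule smat_inverse_unitriangular(2)[OF assms])

lemma nonsingular_diagonalD:
  assumes "nonsingular_diagonal H"
  shows "lower_triangular_smat H" and "H i i \<noteq> 0" and "lower_triangular_smat (smat_transpose H)"
  using assms
  by (auto simp: nonsingular_diagonal_def lower_triangular_smat_def smat_transpose_def)

lemma times_nonsingular_diagonal:
  assumes "nonsingular_diagonal H"
  shows "(A \<star> H) i j = A i j * H j j"
  using assms
  by (subst smat_times_upper[OF nonsingular_diagonalD(3)[OF assms] lessI])
    (auto simp: nonsingular_diagonal_def intro!: sum.neutral)

lemma smat_inverse_diagonal: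
  assumes "nonsingular_diagonal H"
  shows "smat_inverse H = (\<lambda>i j. if i = j then 1 / H j j else 0)"
proof (rule smat_inverse_unique)
  have "nonsingular_diagonal (\<lambda>i j. if i = j then 1 / H j j else 0)"
    using assms by (auto simp: nonsingular_diagonal_def)
  then show "H \<star> (\<lambda>i j. if i = j then 1 / H j j else 0) = smat_one"
    using assms by (intro ext)
      (simp add: times_nonsingular_diagonal smat_one_def nonsingular_diagonal_def)
qed (use nonsingular_diagonalD[OF assms] in auto)

section \<open>Gauss-Borel factorizations and orthogonality\<close>

lemma gauss_borel_triangular:
  assumes "gauss_borel M S H Sb"
  shows "M \<star> smat_transpose Sb = smat_inverse S \<star> H"
proof -
  note gb = assms[unfolded gauss_borel_def]
  have S: "lower_unitriangular S" and Sb: "lower_unitriangular Sb" using gb by auto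
  have "M \<star> smat_transpose Sb
      = smat_inverse S \<star> H \<star> smat_transpose (smat_inverse Sb) \<star> smat_transpose Sb"
    using gb by simp
  also have "\<dots> = smat_inverse S \<star> H \<star> (smat_transpose (smat_inverse Sb) \<star> smat_transpose Sb)"
    by (rule smat_times_assoc_upper)
      (use Sb smat_inverse_unitriangular[OF Sb] lower_unitriangularD in auto)
  also have "smat_transpose (smat_inverse Sb) \<star> smat_transpose Sb = smat_one"
    by (metis smat_transpose_times smat_transpose_one smat_inverse_unitriangular(1)[OF Sb])
  finally show ?thesis by simp
qed

text \<open>The product equals \<open>S^-1 H\<close>. For a moment matrix, the zeros above the
  diagonal are orthogonality relations: column \<open>j\<close> of \<open>X_p^T Sb^T\<close> pairs
  to zero with the rows \<open>i < j\<close> of \<open>X_q\<close>.\<close>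

lemma gauss_borel_triangular_entries:
  assumes "gauss_borel M S H Sb"
  shows "lower_triangular_smat (M \<star> smat_transpose Sb)"
    and "(M \<star> smat_transpose Sb) i i \<noteq> 0"
proof -
  note gb = assms[unfolded gauss_borel_def]
  have S: "lower_unitriangular (smat_inverse S)" and H: "nonsingular_diagonal H"
    using gb smat_inverse_unitriangular by auto
  show "lower_triangular_smat (M \<star> smat_transpose Sb)" "(M \<star> smat_transpose Sb) i i \<noteq> 0"
    unfolding gauss_borel_triangular[OF assms]
    using lower_triangular_smat_times[OF lower_unitriangularD(1)[OF S] nonsingular_diagonalD(1)[OF H]]
      lower_unitriangularD(2)[OF S] nonsingular_diagonalD(2)[OF H] by auto
qed

section \<open>Leading principal minors\<close>

lemma leading_submatrix_carrier [simp]: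
  "leading_submatrix A n \<in> carrier_mat n n"
  "dim_row (leading_submatrix A n) = n" "dim_col (leading_submatrix A n) = n"
  by (auto simp: leading_submatrix_def)

lemma index_leading_submatrix [simp]:
  "i < n \<Longrightarrow> j < n \<Longrightarrow> leading_submatrix A n $$ (i, j) = A i j"
  by (simp add: leading_submatrix_def)

text \<open>Truncation is compatible with the product because the first \<open>n\<close> columns of
  \<open>B\<close> vanish from row \<open>n\<close> on.\<close>

lemma leading_submatrix_times_upper:
  assumes "lower_triangular_smat (smat_transpose B)"
  shows "leading_submatrix (A \<star> B) n = leading_submatrix A n * leading_submatrix B n"
  by (rule eq_matI)
    (auto simp: scalar_prod_def smat_times_upper[OF assms] atLeast0LessThan)

lemma leading_submatrix_transpose:
  "leading_submatrix (smat_transpose A) n = (leading_submatrix A n)\<^sup>T"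
  by (rule eq_matI) (auto simp: smat_transpose_def)

lemma det_leading_submatrix_lower:
  assumes "lower_triangular_smat A"
  shows "det (leading_submatrix A n) = (\<Prod>i<n. A i i)"
  using assms
  by (subst det_lower_triangular[of n])
    (auto simp: lower_triangular_smat_def diag_mat_def prod.list_conv_set_nth atLeast0LessThan
      intro!: prod.cong)

lemma det_leading_submatrix_unitriangular:
  assumes "lower_unitriangular A"
  shows "det (leading_submatrix A n) = 1"
  using det_leading_submatrix_lower[OF lower_unitriangularD(1)[OF assms]]
    lower_unitriangularD(2)[OF assms] by simp

lemma det_leading_submatrix_times_unitriangular:
  assumes "lower_unitriangular B"
  shows "det (leading_submatrix (A \<star> smat_transpose B) n) = det (leading_submatrix A n)"
proof -
  have "leading_submatrix (A \<star> smat_transpose B) n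
      = leading_submatrix A n * (leading_submatrix B n)\<^sup>T"
    unfolding leading_submatrix_transpose[symmetric]
    by (rule leading_submatrix_times_upper) (simp add: lower_unitriangularD[OF assms])
  then have "det (leading_submatrix (A \<star> smat_transpose B) n)
      = det (leading_submatrix A n) * det ((leading_submatrix B n)\<^sup>T)"
    by (simp add: det_mult[of _ n])
  also have "det ((leading_submatrix B n)\<^sup>T) = det (leading_submatrix B n)"
    by (rule det_transpose[of _ n]) simp
  finally show ?thesis
    by (simp add: det_leading_submatrix_unitriangular[OF assms])
qed

text \<open>Row \<open>n\<close> of \<open>Sb\<close> must be a vector ending in 1 at position
  \<open>n\<close> that is annihilated by the first \<open>n\<close> rows of \<open>M\<close>. Its
  first \<open>n\<close> entries solve a linear system whose matrix is the nonsingular leading block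
  of size \<open>n\<close>.\<close>

lemma ex_unitriangular_reduction:
  assumes "\<And>n. det (leading_submatrix M n) \<noteq> 0"
  shows "\<exists>Sb. lower_unitriangular Sb \<and> lower_triangular_smat (M \<star> smat_transpose Sb)"
proof -
  have "\<exists>u. \<forall>i<n. (\<Sum>k<n. M i k * u k) + M i n = 0" for n
  proof -
    let ?M = "leading_submatrix M n"
    obtain B where B: "B \<in> carrier_mat n n" "?M * B = 1\<^sub>m n"
      using det_non_zero_imp_unit[OF leading_submatrix_carrier(1) assms[of n], of n]
      by (auto simp: Units_def ring_mat_def)
    define w where "w = B *\<^sub>v vec n (\<lambda>i. - M i n)"
    have w: "w \<in> carrier_vec n" using B by (simp add: w_def)
    have "?M *\<^sub>v w = vec n (\<lambda>i. - M i n)"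
      unfolding w_def using B by (simp add: assoc_mult_mat_vec[symmetric, of _ n n _ n])
    then have "row ?M i \<bullet> w = - M i n" if "i < n" for i
      using that index_mult_mat_vec[of i ?M w] by simp
    then have "\<forall>i<n. (\<Sum>k<n. M i k * w $ k) + M i n = 0"
      using w by (auto simp: scalar_prod_def atLeast0LessThan)
    then show ?thesis by (intro exI[of _ "\<lambda>k. w $ k"])
  qed
  then obtain u where u: "\<And>n i. i < n \<Longrightarrow> (\<Sum>k<n. M i k * u n k) + M i n = 0"
    by metis
  define Sb where "Sb = (\<lambda>n k. if k < n then u n k else if k = n then 1 else (0::complex))"
  have Sb: "lower_unitriangular Sb"
    by (auto simp: lower_unitriangular_def Sb_def)
  have "(M \<star> smat_transpose Sb) i j = 0" if "i < j" for i j
  proof -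
    have "(M \<star> smat_transpose Sb) i j = (\<Sum>k<Suc j. M i k * Sb j k)"
      by (subst smat_times_upper[of _ _ "Suc j"])
        (use lower_unitriangularD(1)[OF Sb] in \<open>auto simp: smat_transpose_def\<close>)
    also have "\<dots> = 0" using u[OF that] by (simp add: Sb_def)
    finally show ?thesis .
  qed
  then show ?thesis using Sb by (auto simp: lower_triangular_smat_def)
qed

text \<open>Multiplication by \<open>Sb^T\<close> preserves the leading minors and makes the matrix
  triangular, so the minors are products of diagonal entries. Conversely, splitting off the diagonal
  \<open>H\<close> of the triangular matrix \<open>T\<close> leaves a unitriangular
  \<open>K\<close>, which serves as the inverse of \<open>S\<close>.\<close>

lemma ex_gauss_borel_iff:
  "(\<exists>S H Sb. gauss_borel M S H Sb) \<longleftrightarrow> (\<forall>n. det (leading_submatrix M n) \<noteq> 0)"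
proof
  assume "\<exists>S H Sb. gauss_borel M S H Sb"
  then obtain S H Sb where gb: "gauss_borel M S H Sb" by blast
  then have Sb: "lower_unitriangular Sb" by (simp add: gauss_borel_def)
  show "\<forall>n. det (leading_submatrix M n) \<noteq> 0"
    unfolding det_leading_submatrix_times_unitriangular[OF Sb, of M, symmetric]
      det_leading_submatrix_lower[OF gauss_borel_triangular_entries(1)[OF gb]]
    using gauss_borel_triangular_entries(2)[OF gb] by simp
next
  assume minors: "\<forall>n. det (leading_submatrix M n) \<noteq> 0"
  then obtain Sb where Sb: "lower_unitriangular Sb"
    and T: "lower_triangular_smat (M \<star> smat_transpose Sb)"
    using ex_unitriangular_reduction by blast
  define T where "T = M \<star> smat_transpose Sb"
  define H where "H = (\<lambda>i j. if i = j then T j j else 0)"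
  define K where "K = (\<lambda>i j. T i j / T j j)"
  \<comment> \<open>The minor of size \<open>Suc i\<close> is a product that contains
    \<open>T i i\<close> as a factor.\<close>
  have nz: "T i i \<noteq> 0" for i
    using minors[THEN spec, of "Suc i"] det_leading_submatrix_times_unitriangular[OF Sb, of M "Suc i"]
      det_leading_submatrix_lower[OF T, of "Suc i"]
    by (auto simp: T_def)
  have H: "nonsingular_diagonal H" using nz by (auto simp: nonsingular_diagonal_def H_def)
  have K: "lower_unitriangular K"
    using nz T by (auto simp: K_def lower_unitriangular_def lower_triangular_smat_def T_def)
  have KH: "K \<star> H = T"
    using nz by (intro ext, subst times_nonsingular_diagonal[OF H]) (simp add: K_def H_def)
  note Sbi = smat_inverse_unitriangular[OF Sb]
  have "M = M \<star> (smat_transpose Sb \<star> smat_transpose (smat_inverse Sb))"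
    by (simp add: smat_transpose_times[symmetric] Sbi)
  also have "\<dots> = K \<star> H \<star> smat_transpose (smat_inverse Sb)"
    unfolding KH T_def
    by (rule smat_times_assoc_upper[symmetric]) (use Sb Sbi lower_unitriangularD in auto)
  finally have "gauss_borel M (smat_inverse K) H Sb"
    using smat_inverse_unitriangular[OF K] smat_inverse_smat_inverse[OF K] H Sb
    by (simp add: gauss_borel_def)
  then show "\<exists>S H Sb. gauss_borel M S H Sb" by blast
qed

section \<open>Comparison of a minor with a spectral determinant\<close>

text \<open>A vector annihilated by all rows of \<open>B\<close> is annihilated by all rows of
  \<open>A\<close>. Used in both directions, this compares two orderings of the same rows without
  the sign of a permutation.\<close>

lemma det_eq_0_if_rows_subset:
  fixes A B :: "'a :: idom mat"
  assumes "A \<in> carrier_mat n n" and "B \<in> carrier_mat n n"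
    and "set (rows A) \<subseteq> set (rows B)" and "det B = 0"
  shows "det A = 0"
proof -
  obtain v where v: "v \<in> carrier_vec n" "v \<noteq> 0\<^sub>v n" "B *\<^sub>v v = 0\<^sub>v n"
    using assms(4) det_0_iff_vec_prod_zero[OF assms(2)] by blast
  have B: "row B i \<bullet> v = 0" if "i < n" for i
    using that assms(2) index_mult_mat_vec[of i B v] v(3) by simp
  have "row A i \<bullet> v = 0" if "i < n" for i
  proof -
    have "row A i \<in> set (rows B)"
      using that assms(1,3) by (auto simp: rows_def)
    then show ?thesis using assms(2) B by (auto simp: rows_def)
  qed
  then have "A *\<^sub>v v = 0\<^sub>v n"
    using assms(1) by (intro eq_vecI) auto
  then show ?thesis
    using v det_0_iff_vec_prod_zero[OF assms(1)] by blast
qed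

text \<open>A dependency between the rows of the first \<open>d\<close> columns would propagate to
  all columns: since \<open>L (j + d) j\<close> is the last nonzero entry of its column,
  \<open>F L = 0\<close> expresses column \<open>j + d\<close> of \<open>F\<close> through earlier
  ones. This contradicts the independence of the full rows.\<close>

lemma det_spectral_block_nonzero:
  fixes F L :: "complex smat"
  assumes L: "\<And>k j. k > j + d \<Longrightarrow> L k j = 0" "\<And>j. L (j + d) j \<noteq> 0"
    and FL: "\<And>m j. m < d \<Longrightarrow> (\<Sum>k\<le>j + d. F m k * L k j) = 0"
    and F: "\<And>\<alpha>. (\<And>k. (\<Sum>m<d. \<alpha> m * F m k) = 0) \<Longrightarrow> \<forall>m<d. \<alpha> m = 0"
  shows "det (leading_submatrix F d) \<noteq> 0"
proof
  assume "det (leading_submatrix F d) = 0"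
  then have "det ((leading_submatrix F d)\<^sup>T) = 0"
    by (subst det_transpose) auto
  then obtain v where v: "v \<in> carrier_vec d" "v \<noteq> 0\<^sub>v d" "(leading_submatrix F d)\<^sup>T *\<^sub>v v = 0\<^sub>v d"
    by (subst (asm) det_0_iff_vec_prod_zero[of _ d]) auto
  have "(\<Sum>m<d. v $ m * F m k) = 0" for k
  proof (induction k rule: less_induct)
    case (less k)
    show ?case
    proof (cases "k < d")
      case True
      then have "((leading_submatrix F d)\<^sup>T *\<^sub>v v) $ k = (\<Sum>m<d. v $ m * F m k)"
        using v(1) by (auto simp: scalar_prod_def atLeast0LessThan mult.commute)
      then show ?thesis using v(3) True by simp
    next
      case False
      define j where "j = k - d"
      have k: "k = j + d" using False by (simp add: j_def)
      have "0 = (\<Sum>m<d. v $ m * (\<Sum>l\<le>j + d. F m l * L l j))"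
        using FL by simp
      also have "\<dots> = (\<Sum>l\<le>j + d. (\<Sum>m<d. v $ m * F m l) * L l j)"
        unfolding sum_distrib_left sum_distrib_right
        by (subst sum.swap) (simp only: mult.assoc)
      also have "\<dots> = (\<Sum>l<k. (\<Sum>m<d. v $ m * F m l) * L l j) + (\<Sum>m<d. v $ m * F m k) * L k j"
        unfolding k by (simp add: lessThan_Suc_atMost[symmetric])
      also have "(\<Sum>l<k. (\<Sum>m<d. v $ m * F m l) * L l j) = 0"
        by (intro sum.neutral) (simp add: less.IH)
      finally show ?thesis using L(2)[of j] k by simp
    qed
  qed
  from F[OF this] v(1,2) show False by auto
qed

text \<open>
  The stacked matrix times \<open>U\<close> has the blocks \<open>M U\<close> (lower triangular) and the spectral determinant;
  times the unit vectors \<open>e\<^sub>0, \<dots>, e\<^sub>d\<^sub>-\<^sub>1\<close> followed by \<open>n\<close> columns of \<open>L\<close> it has the blocks \<open>F\<close> and \<open>M L\<close>.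
\<close>

lemma det_minor_iff_det_spectral:
  fixes M L U F :: "complex smat"
  assumes U: "lower_triangular_smat (smat_transpose U)" "\<And>i. U i i \<noteq> 0"
    and T: "lower_triangular_smat (M \<star> U)" "\<And>i. (M \<star> U) i i \<noteq> 0"
    and L: "\<And>k j. k > j + d \<Longrightarrow> L k j = 0" "\<And>j. L (j + d) j \<noteq> 0"
    and FL: "\<And>m j. m < d \<Longrightarrow> (\<Sum>k\<le>j + d. F m k * L k j) = 0"
    and F: "\<And>\<alpha>. (\<And>k. (\<Sum>m<d. \<alpha> m * F m k) = 0) \<Longrightarrow> \<forall>m<d. \<alpha> m = 0"
  shows "det (leading_submatrix (M \<star> L) n) \<noteq> 0 \<longleftrightarrow>
    det (mat d d (\<lambda>(m, j). (F \<star> U) m (n + j))) \<noteq> 0"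
proof -
  \<comment> \<open>\<open>B\<close> and \<open>B'\<close> have the same rows in two block orders,
    chosen so that each of the products \<open>B V\<close> and \<open>B' E\<close> below has a zero
    upper right block.\<close>
  define B where "B = mat (n + d) (n + d) (\<lambda>(i, k). if i < n then M i k else F (i - n) k)"
  define B' where "B' = mat (n + d) (n + d) (\<lambda>(i, k). if i < d then F i k else M (i - d) k)"
  \<comment> \<open>The shift by \<open>d\<close> brings the entries \<open>L (j + d) j\<close> to
    the diagonal, so \<open>E\<close> is upper triangular with nonzero diagonal.\<close>
  define E where "E = mat (n + d) (n + d)
    (\<lambda>(k, j). if j < d then if k = j then 1 else 0 else L k (j - d))"
  define V where "V = leading_submatrix U (n + d)"
  let ?\<tau> = "mat d d (\<lambda>(m, j). (F \<star> U) m (n + j))"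
  have carrier: "B \<in> carrier_mat (n + d) (n + d)" "B' \<in> carrier_mat (n + d) (n + d)"
    "E \<in> carrier_mat (n + d) (n + d)" "V \<in> carrier_mat (n + d) (n + d)"
    by (simp_all add: B_def B'_def E_def V_def)
  have "det V \<noteq> 0"
  proof -
    have "V = (leading_submatrix (smat_transpose U) (n + d))\<^sup>T"
      by (simp add: V_def leading_submatrix_transpose)
    then have "det V = (\<Prod>i<n + d. U i i)"
      using det_leading_submatrix_lower[OF U(1), of "n + d"]
      by (simp add: det_transpose[of _ "n + d"]) (simp add: smat_transpose_def)
    then show ?thesis using U(2) by simp
  qed
  moreover have "det B * det V = det (leading_submatrix (M \<star> U) n) * det ?\<tau>"
  proof -
    have "B * V = four_block_mat (leading_submatrix (M \<star> U) n) (0\<^sub>m n d)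
        (mat d n (\<lambda>(m, j). (F \<star> U) m j)) ?\<tau>"
    proof (rule eq_matI, goal_cases)
      case (1 i j)
      then have ij: "i < n + d" "j < n + d" by auto
      have "(B * V) $$ (i, j) = (\<Sum>k<n + d. B $$ (i, k) * U k j)"
        using ij by (simp add: V_def B_def scalar_prod_def atLeast0LessThan)
      also have "\<dots> = (if i < n then (M \<star> U) i j else (F \<star> U) (i - n) j)"
        using ij by (auto simp: B_def smat_times_upper[OF U(1), of j "n + d"])
      finally show ?case
        using ij T(1) by (auto simp: lower_triangular_smat_def)
    qed (auto simp: carrier[THEN carrier_matD(1)] carrier[THEN carrier_matD(2)])
    then have "det (B * V) = det (leading_submatrix (M \<star> U) n) * det ?\<tau>"
      by (simp add: det_four_block_mat_upper_right_zero[of _ n _ d])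
    then show ?thesis by (simp add: det_mult[OF carrier(1,4)])
  qed
  moreover have "det (leading_submatrix (M \<star> U) n) \<noteq> 0"
    by (simp add: det_leading_submatrix_lower[OF T(1)] T(2))
  ultimately have 1: "det B \<noteq> 0 \<longleftrightarrow> det ?\<tau> \<noteq> 0"
    by auto
  have "det E \<noteq> 0"
  proof -
    have "det E = prod_list (diag_mat E)"
      by (rule det_upper_triangular[OF _ carrier(3)])
        (auto simp: upper_triangular_def E_def L(1))
    moreover have "E $$ (i, i) \<noteq> 0" if "i < n + d" for i
      using that L(2)[of "i - d"] by (auto simp: E_def)
    ultimately show ?thesis
      using carrier(3) by (auto simp: diag_mat_def)
  qed
  moreover have "det B' * det E = det (leading_submatrix F d) * det (leading_submatrix (M \<star> L) n)"
  proof -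
    have "B' * E = four_block_mat (leading_submatrix F d) (0\<^sub>m d n)
        (mat n d (\<lambda>(i, j). M i j)) (leading_submatrix (M \<star> L) n)"
    proof (rule eq_matI, goal_cases)
      case (1 i j)
      then have ij: "i < n + d" "j < n + d" by auto
      have eq: "(B' * E) $$ (i, j) = (\<Sum>k<n + d. B' $$ (i, k) * E $$ (k, j))"
        using ij carrier by (simp add: scalar_prod_def atLeast0LessThan)
      show ?case
      proof (cases "j < d")
        case True
        have "(B' * E) $$ (i, j) = (\<Sum>k<n + d. if k = j then B' $$ (i, j) else 0)"
          unfolding eq using True ij by (intro sum.cong) (auto simp: E_def)
        then show ?thesis using True ij by (auto simp: B'_def)
      next
        case False
        define j' where "j' = j - d"
        have j: "j = j' + d" "j' < n" using False ij by (auto simp: j'_def)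
        have "(B' * E) $$ (i, j) = (\<Sum>k<n + d. (if i < d then F i k else M (i - d) k) * L k j')"
          unfolding eq using j ij by (intro sum.cong) (auto simp: E_def B'_def)
        also have "\<dots> = (if i < d then 0 else (M \<star> L) (i - d) j')"
        proof (cases "i < d")
          case True
          have "(\<Sum>k<n + d. F i k * L k j') = (\<Sum>k\<le>j' + d. F i k * L k j')"
            using j(2) by (intro sum.mono_neutral_right) (auto simp: L(1))
          then show ?thesis using FL[OF True] True by simp
        next
          case i: False
          have "(M \<star> L) (i - d) j' = (\<Sum>k<n + d. M (i - d) k * L k j')"
            by (rule smat_times_eq_sum) (use j(2) L(1) in auto)
          then show ?thesis using i by simp
        qed
        finally show ?thesis using ij j by auto
      qed
    qed (use carrier in auto)
    then have "det (B' * E) = det (leading_submatrix F d) * det (leading_submatrix (M \<star> L) n)"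
      by (simp add: det_four_block_mat_upper_right_zero[of _ d _ n])
    then show ?thesis by (simp add: det_mult[OF carrier(2,3)])
  qed
  moreover have "det (leading_submatrix F d) \<noteq> 0"
    by (rule det_spectral_block_nonzero) fact+
  ultimately have 2: "det B' \<noteq> 0 \<longleftrightarrow> det (leading_submatrix (M \<star> L) n) \<noteq> 0"
    by auto
  have "set (rows B) \<subseteq> set (rows B')"
  proof
    fix v assume "v \<in> set (rows B)"
    then obtain i where i: "i < n + d" "v = row B i" by (auto simp: rows_def B_def)
    then have "v = row B' (if i < n then i + d else i - n)"
      by (intro eq_vecI) (auto simp: B_def B'_def)
    moreover have "(if i < n then i + d else i - n) < n + d" using i(1) by auto
    ultimately show "v \<in> set (rows B')" by (force simp: rows_def B'_def)
  qed
  moreover have "set (rows B') \<subseteq> set (rows B)"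
  proof
    fix v assume "v \<in> set (rows B')"
    then obtain i where i: "i < n + d" "v = row B' i" by (auto simp: rows_def B'_def)
    then have "v = row B (if i < d then i + n else i - d)"
      by (intro eq_vecI) (auto simp: B_def B'_def)
    moreover have "(if i < d then i + n else i - d) < n + d" using i(1) by auto
    ultimately show "v \<in> set (rows B)" by (force simp: rows_def B_def)
  qed
  ultimately have "det B = 0 \<longleftrightarrow> det B' = 0"
    using det_eq_0_if_rows_subset carrier(1,2) by metis
  with 1 2 show ?thesis by simp
qed

section \<open>Moments\<close>

text \<open>Allows any vector of polynomials in place of the column \<open>X_stack p j\<close> in a
  moment, so that linearity in this vector can be used.\<close>

definition pairing ::
    "nat \<Rightarrow> nat \<Rightarrow> real measure \<Rightarrow> (real \<Rightarrow> complex mat) \<Rightarrow> nat \<Rightarrow> (nat \<Rightarrow> complex poly) \<Rightarrow> complex"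
  where "pairing q p \<nu> W i f = (LINT x|\<nu>. (\<Sum>b<q. \<Sum>a<p.
    poly (X_stack q i b) (complex_of_real x) * W x $$ (b, a) * poly (f a) (complex_of_real x)))"

lemma moment_matrix_eq_pairing: "moment_matrix q p \<nu> W i j = pairing q p \<nu> W i (X_stack p j)"
  by (simp add: moment_matrix_def pairing_def)

lemma pairing_cong:
  "(\<And>a. a < p \<Longrightarrow> f a = g a) \<Longrightarrow> pairing q p \<nu> W i f = pairing q p \<nu> W i g"
  by (simp add: pairing_def)

lemma integrable_poly_density:
  assumes "matrix_of_measures q p \<Delta> \<nu> W" and "b < q" and "a < p"
  shows "integrable \<nu> (\<lambda>x. poly f (complex_of_real x) * W x $$ (b, a))"
proof -
  have "integrable \<nu> (\<lambda>x. \<Sum>k\<le>degree f. coeff f k * (complex_of_real x ^ k * W x $$ (b, a)))"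
    using assms by (intro integrable_sum integrable_mult_right)
      (auto simp: matrix_of_measures_def)
  then show ?thesis by (simp add: poly_altdef sum_distrib_right mult.assoc)
qed

lemma integrable_pairing:
  assumes "matrix_of_measures q p \<Delta> \<nu> W"
  shows "integrable \<nu> (\<lambda>x. \<Sum>b<q. \<Sum>a<p.
    poly (X_stack q i b) (complex_of_real x) * W x $$ (b, a) * poly (f a) (complex_of_real x))"
proof (intro integrable_sum)
  fix b a assume "b \<in> {..<q}" "a \<in> {..<p}"
  then have "integrable \<nu> (\<lambda>x. poly (X_stack q i b * f a) (complex_of_real x) * W x $$ (b, a))"
    by (intro integrable_poly_density[OF assms]) auto
  then show "integrable \<nu> (\<lambda>x.
      poly (X_stack q i b) (complex_of_real x) * W x $$ (b, a) * poly (f a) (complex_of_real x))"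
    by (simp add: mult_ac)
qed

lemma pairing_sum:
  assumes "matrix_of_measures q p \<Delta> \<nu> W"
  shows "pairing q p \<nu> W i (\<lambda>a. \<Sum>j\<in>J. Polynomial.smult (c j) (g j a)) = (\<Sum>j\<in>J. c j * pairing q p \<nu> W i (g j))"
proof -
  have "pairing q p \<nu> W i (\<lambda>a. \<Sum>j\<in>J. Polynomial.smult (c j) (g j a)) = (LINT x|\<nu>. (\<Sum>j\<in>J. c j *
      (\<Sum>b<q. \<Sum>a<p. poly (X_stack q i b) (complex_of_real x) * W x $$ (b, a)
        * poly (g j a) (complex_of_real x))))"
    unfolding pairing_def
  proof (rule Bochner_Integration.integral_cong[OF refl])
    fix x
    let ?w = "\<lambda>b a. poly (X_stack q i b) (complex_of_real x) * W x $$ (b, a)"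
    have "(\<Sum>b<q. \<Sum>a<p. ?w b a * poly (\<Sum>j\<in>J. Polynomial.smult (c j) (g j a)) (complex_of_real x))
        = (\<Sum>b<q. \<Sum>a<p. \<Sum>j\<in>J. c j * (?w b a * poly (g j a) (complex_of_real x)))"
      by (simp add: poly_sum sum_distrib_left mult.left_commute)
    also have "\<dots> = (\<Sum>b<q. \<Sum>j\<in>J. \<Sum>a<p. c j * (?w b a * poly (g j a) (complex_of_real x)))"
      by (intro sum.cong refl sum.swap)
    also have "\<dots> = (\<Sum>j\<in>J. c j * (\<Sum>b<q. \<Sum>a<p. ?w b a * poly (g j a) (complex_of_real x)))"
      by (subst sum.swap) (simp add: sum_distrib_left)
    finally show "(\<Sum>b<q. \<Sum>a<p. ?w b a * poly (\<Sum>j\<in>J. Polynomial.smult (c j) (g j a)) (complex_of_real x))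
        = (\<Sum>j\<in>J. c j * (\<Sum>b<q. \<Sum>a<p. ?w b a * poly (g j a) (complex_of_real x)))" .
  qed
  also have "\<dots> = (\<Sum>j\<in>J. c j * pairing q p \<nu> W i (g j))"
    unfolding pairing_def
    by (subst Bochner_Integration.integral_sum)
      (use integrable_pairing[OF assms] in \<open>auto intro!: integrable_mult_right\<close>)
  finally show ?thesis .
qed

lemma sum_mult_X_stack:
  assumes "p > 0"
  shows "(\<Sum>c<p. P $$ (a, c) * X_stack p j c) = monom 1 (j div p) * P $$ (a, j mod p)"
proof -
  have "(\<Sum>c<p. P $$ (a, c) * X_stack p j c)
      = (\<Sum>c<p. if c = j mod p then monom 1 (j div p) * P $$ (a, j mod p) else 0)"
    by (intro sum.cong) (auto simp: X_stack_def mult.commute)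
  then show ?thesis using assms by simp
qed

text \<open>By associativity of \<open>(W P) X = W (P X)\<close>, the perturbation moves from the
  measures to the polynomial vectors.\<close>

lemma moment_matrix_perturbed:
  assumes "matrix_of_measures q p \<Delta> \<nu> W" and "P \<in> carrier_mat p p"
  shows "moment_matrix q p \<nu> (perturbed_density W P) i j
    = pairing q p \<nu> W i (\<lambda>a. \<Sum>c<p. P $$ (a, c) * X_stack p j c)"
  unfolding moment_matrix_def pairing_def
proof (rule Bochner_Integration.integral_cong[OF refl])
  fix x assume "x \<in> space \<nu>"
  \<comment> \<open>The shape of \<open>W x\<close> is known for \<open>x\<close> in \<Delta>, while
    the integrands are compared on the space of \<nu>.\<close>
  moreover have "space \<nu> = \<Delta>"
    using assms(1) sets_eq_imp_space_eq[of \<nu> "restrict_space borel \<Delta>"]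
    by (simp add: matrix_of_measures_def space_restrict_space)
  ultimately have W: "W x \<in> carrier_mat q p"
    using assms(1) by (simp add: matrix_of_measures_def)
  let ?u = "\<lambda>b. poly (X_stack q i b) (complex_of_real x)"
    and ?v = "\<lambda>c. poly (X_stack p j c) (complex_of_real x)"
    and ?P = "\<lambda>a c. poly (P $$ (a, c)) (complex_of_real x)"
  have "perturbed_density W P x $$ (b, c) = (\<Sum>a<p. W x $$ (b, a) * ?P a c)"
    if "b < q" "c < p" for b c
    using that W assms(2)
    by (auto simp: perturbed_density_def eval_mat_def scalar_prod_def atLeast0LessThan
        intro!: sum.cong)
  then have "(\<Sum>b<q. \<Sum>c<p. ?u b * perturbed_density W P x $$ (b, c) * ?v c)
      = (\<Sum>b<q. \<Sum>c<p. \<Sum>a<p. ?u b * W x $$ (b, a) * (?P a c * ?v c))"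
    by (simp add: sum_distrib_left sum_distrib_right mult.assoc)
  also have "\<dots> = (\<Sum>b<q. \<Sum>a<p. \<Sum>c<p. ?u b * W x $$ (b, a) * (?P a c * ?v c))"
    by (intro sum.cong refl sum.swap)
  finally show "(\<Sum>b<q. \<Sum>c<p. ?u b * perturbed_density W P x $$ (b, c) * ?v c)
      = (\<Sum>b<q. \<Sum>a<p. ?u b * W x $$ (b, a)
        * poly (\<Sum>c<p. P $$ (a, c) * X_stack p j c) (complex_of_real x))"
    by (simp add: poly_sum sum_distrib_left)
qed

section \<open>Jordan chain functionals\<close>

text \<open>The basis index \<open>k\<close> stands for degree \<open>k div p\<close> in component
  \<open>k mod p\<close>, so the coordinates of a polynomial vector are its coefficients read in
  this order.\<close>

lemma X_stack_expansion:
  assumes "a < p" and "\<And>k. k \<ge> n \<Longrightarrow> coeff (f (k mod p)) (k div p) = 0"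
  shows "f a = (\<Sum>k<n. Polynomial.smult (coeff (f (k mod p)) (k div p)) (X_stack p k a))"
proof (rule poly_eqI)
  fix i
  have coeff_X: "coeff (X_stack p k a) i = (if k = i * p + a then 1 else 0)" for k
  proof -
    have "k = i * p + a \<longleftrightarrow> k mod p = a \<and> k div p = i"
    proof
      assume "k mod p = a \<and> k div p = i"
      then show "k = i * p + a" using div_mult_mod_eq[of k p] by simp
    qed (use assms(1) in simp)
    then show ?thesis by (auto simp: X_stack_def)
  qed
  have "coeff (\<Sum>k<n. Polynomial.smult (coeff (f (k mod p)) (k div p)) (X_stack p k a)) i
      = (\<Sum>k<n. if k = i * p + a then coeff (f a) i else 0)"
    unfolding coeff_sum
    using assms(1) by (intro sum.cong refl) (simp add: coeff_X)
  also have "\<dots> = coeff (f a) i"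
    using assms(2)[of "i * p + a"] assms(1) by (auto simp: not_less)
  finally show "coeff (f a) i
      = coeff (\<Sum>k<n. Polynomial.smult (coeff (f (k mod p)) (k div p)) (X_stack p k a)) i" ..
qed

text \<open>The chain becomes the polynomial row \<open>v(t) = v_0 + v_1 t + ...\<close>, and the
  functional is the coefficient of \<open>t^k\<close> in \<open>v(t) f(z + t)\<close>. Divisibility
  arguments thereby replace manipulations of derivatives.\<close>

definition chain_functional ::
    "nat \<Rightarrow> complex \<Rightarrow> complex vec list \<Rightarrow> nat \<Rightarrow> (nat \<Rightarrow> complex poly) \<Rightarrow> complex"
  where "chain_functional p z v k f =
    coeff (\<Sum>a<p. Poly (map (\<lambda>w. w $ a) v) * pcompose (f a) [:z, 1:]) k"

lemma chain_functional_cong: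
  "(\<And>a. a < p \<Longrightarrow> f a = g a) \<Longrightarrow> chain_functional p z v k f = chain_functional p z v k g"
  by (simp add: chain_functional_def)

lemma smult_sum_right: "Polynomial.smult c (\<Sum>i\<in>I. f i) = (\<Sum>i\<in>I. Polynomial.smult c (f i))"
  by (induction I rule: infinite_finite_induct) (simp_all add: smult_add_right)

lemma chain_functional_sum:
  "chain_functional p z v k (\<lambda>a. \<Sum>j\<in>J. Polynomial.smult (c j) (g j a))
    = (\<Sum>j\<in>J. c j * chain_functional p z v k (g j))"
proof -
  have "(\<Sum>a<p. Poly (map (\<lambda>w. w $ a) v) * pcompose (\<Sum>j\<in>J. Polynomial.smult (c j) (g j a)) [:z, 1:])
      = (\<Sum>a<p. \<Sum>j\<in>J. Polynomial.smult (c j) (Poly (map (\<lambda>w. w $ a) v) * pcompose (g j a) [:z, 1:]))"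
    by (simp add: pcompose_sum pcompose_smult sum_distrib_left)
  also have "\<dots> = (\<Sum>j\<in>J. Polynomial.smult (c j) (\<Sum>a<p. Poly (map (\<lambda>w. w $ a) v) * pcompose (g j a) [:z, 1:]))"
    by (subst sum.swap) (simp add: smult_sum_right)
  finally show ?thesis by (simp add: chain_functional_def coeff_sum)
qed

text \<open>Taylor's formula: the shift has derivative 1, so it commutes with
  differentiation.\<close>

lemma coeff_pcompose_shift:
  fixes f :: "complex poly"
  shows "coeff (pcompose f [:z, 1:]) l = poly ((pderiv ^^ l) f) z / fact l"
proof -
  have "(pderiv ^^ l) (pcompose f [:z, 1:]) = pcompose ((pderiv ^^ l) f) [:z, 1:]"
    by (induction l) (simp_all add: pderiv_pcompose pderiv_pCons)
  then have "poly ((pderiv ^^ l) (pcompose f [:z, 1:])) 0 = poly ((pderiv ^^ l) f) z"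
    by (simp add: poly_pcompose)
  moreover have "poly ((pderiv ^^ l) (pcompose f [:z, 1:])) 0 = fact l * coeff (pcompose f [:z, 1:]) l"
    by (simp add: poly_0_coeff_0 coeff_higher_pderiv pochhammer_fact)
  ultimately show ?thesis by (simp add: field_simps)
qed

text \<open>The sum is the Cauchy product of the chain with the Taylor coefficients of
  \<open>u\<close> at \<open>z\<close>. It occurs both in the spectral vectors and in the chain
  condition.\<close>

lemma chain_functional_eq_derivatives:
  assumes "set v \<subseteq> carrier_vec p" and "k < length v" and "u \<in> carrier_vec p"
  shows "(\<Sum>l\<le>k. 1 / fact l * (v ! (k - l) \<bullet> deriv_vec_at u l z))
    = chain_functional p z v k (\<lambda>a. u $ a)"
proof -
  \<comment> \<open>As \<open>k < length v\<close>, every index \<open>k - l\<close> lies in the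
    list, so the coefficients of \<open>Poly\<close> are genuine chain entries and not the default
    0.\<close>
  have "chain_functional p z v k (\<lambda>a. u $ a)
      = (\<Sum>a<p. \<Sum>l\<le>k. coeff (pcompose (u $ a) [:z, 1:]) l * v ! (k - l) $ a)"
    unfolding chain_functional_def coeff_sum
    by (subst mult.commute, subst coeff_mult, intro sum.cong refl)
      (use assms(2) in \<open>simp add: nth_default_def\<close>)
  also have "\<dots> = (\<Sum>l\<le>k. \<Sum>a<p. coeff (pcompose (u $ a) [:z, 1:]) l * v ! (k - l) $ a)"
    by (rule sum.swap)
  also have "\<dots> = (\<Sum>l\<le>k. 1 / fact l * (v ! (k - l) \<bullet> deriv_vec_at u l z))"
  proof (intro sum.cong refl)
    fix l assume "l \<in> {..k}"
    have "v ! (k - l) \<bullet> deriv_vec_at u l z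
        = (\<Sum>a<p. v ! (k - l) $ a * poly ((pderiv ^^ l) (u $ a)) z)"
      using assms(3) by (auto simp: scalar_prod_def deriv_vec_at_def atLeast0LessThan)
    then show "(\<Sum>a<p. coeff (pcompose (u $ a) [:z, 1:]) l * v ! (k - l) $ a)
        = 1 / fact l * (v ! (k - l) \<bullet> deriv_vec_at u l z)"
      by (simp add: coeff_pcompose_shift sum_divide_distrib mult.commute)
  qed
  finally show ?thesis ..
qed

lemma coeff_mult_eq_0:
  fixes f g :: "'a :: comm_semiring_0 poly"
  assumes "\<And>i. i \<le> k \<Longrightarrow> coeff f i = 0"
  shows "coeff (f * g) k = 0"
  using assms by (simp add: coeff_mult)

text \<open>
  In the local variable \<open>x - z\<close>, a Jordan chain is a row of polynomials whose product with \<open>P\<close> vanishes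
  to order \<open>\<kappa>\<close> at \<open>0\<close>.
\<close>

lemma chain_functional_multiple_eq_0:
  assumes "jordan_chain p P z v" and "P \<in> carrier_mat p p" and "k < length v"
  shows "chain_functional p z v k (\<lambda>a. \<Sum>c<p. P $$ (a, c) * g c) = 0"
proof -
  let ?V = "\<lambda>a. Poly (map (\<lambda>w. w $ a) v)" and ?s = "[:z, 1:]"
  have zero: "coeff (\<Sum>a<p. ?V a * pcompose (P $$ (a, c)) ?s) i = 0" if "i < length v" "c < p" for i c
  proof -
    have "set v \<subseteq> carrier_vec p" using assms(1) by (simp add: jordan_chain_def)
    moreover have "col P c \<in> carrier_vec p" using assms(2) by auto
    ultimately have "chain_functional p z v i (\<lambda>a. col P c $ a)
        = (\<Sum>l\<le>i. 1 / fact l * (v ! (i - l) \<bullet> deriv_vec_at (col P c) l z))"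
      using chain_functional_eq_derivatives that(1) by simp
    also have "\<dots> = (\<Sum>l\<le>i. 1 / fact l * (v ! (i - l) \<bullet> col (deriv_mat_at P l z) c))"
      using assms(2) that(2)
      by (intro sum.cong refl arg_cong2[of _ _ _ _ "(*)"] arg_cong2[of _ _ _ _ "(\<bullet>)"])
        (auto simp: deriv_vec_at_def deriv_mat_at_def)
    also have "\<dots> = 0" using assms(1) that by (simp add: jordan_chain_def)
    finally show ?thesis using assms(2) that(2) by (simp add: chain_functional_def)
  qed
  have "(\<Sum>a<p. ?V a * pcompose (\<Sum>c<p. P $$ (a, c) * g c) ?s)
      = (\<Sum>c<p. (\<Sum>a<p. ?V a * pcompose (P $$ (a, c)) ?s) * pcompose (g c) ?s)"
    by (simp add: pcompose_sum pcompose_mult sum_distrib_left sum_distrib_right mult.assoc)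
      (rule sum.swap)
  then have "chain_functional p z v k (\<lambda>a. \<Sum>c<p. P $$ (a, c) * g c)
      = (\<Sum>c<p. coeff ((\<Sum>a<p. ?V a * pcompose (P $$ (a, c)) ?s) * pcompose (g c) ?s) k)"
    by (simp add: chain_functional_def coeff_sum)
  also have "\<dots> = 0"
    by (intro sum.neutral ballI coeff_mult_eq_0) (use zero assms(3) in auto)
  finally show ?thesis .
qed

section \<open>The list of all chain functionals and its linear independence\<close>

definition spectral_index ::
    "complex list \<Rightarrow> (nat \<Rightarrow> complex vec list list) \<Rightarrow> (complex \<times> complex vec list \<times> nat) list"
  where "spectral_index xs C = concat (map (\<lambda>i. concat (map (\<lambda>v.
    map (\<lambda>k. (xs ! i, v, k)) [0..<length v]) (C i))) [0..<length xs])"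

definition spectral_functional ::
    "nat \<Rightarrow> complex \<times> complex vec list \<times> nat \<Rightarrow> (nat \<Rightarrow> complex poly) \<Rightarrow> complex"
  where "spectral_functional p = (\<lambda>(z, v, k). chain_functional p z v k)"

lemma set_spectral_index:
  "set (spectral_index xs C) = {(z, v, k). \<exists>i<length xs. z = xs ! i \<and> v \<in> set (C i) \<and> k < length v}"
  by (fastforce simp: spectral_index_def)

text \<open>The labels in \<open>spectral_index\<close> follow the order of stacking, so a column of
  the \<tau> determinant lists the values of the functionals at one polynomial vector.\<close>

lemma concat_spectral_entries:
  assumes "\<And>i v. i < length xs \<Longrightarrow> v \<in> set (C i) \<Longrightarrow> set v \<subseteq> carrier_vec p"
    and "u \<in> carrier_vec p"
  shows "concat (map (\<lambda>i. spectral_entries u (xs ! i) (C i)) [0..<length xs])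
    = map (\<lambda>t. spectral_functional p t (\<lambda>a. u $ a)) (spectral_index xs C)"
  unfolding spectral_index_def map_concat map_map o_def spectral_functional_def prod.case
    spectral_entries_def
  by (intro arg_cong[of _ _ concat] map_cong refl)
    (use assms chain_functional_eq_derivatives in auto)

lemma distinct_concat_map:
  assumes "distinct l" and "\<And>x. x \<in> set l \<Longrightarrow> distinct (f x)"
    and "\<And>x y. x \<in> set l \<Longrightarrow> y \<in> set l \<Longrightarrow> x \<noteq> y \<Longrightarrow> set (f x) \<inter> set (f y) = {}"
  shows "distinct (concat (map f l))"
  using assms
proof (induction l)
  case (Cons x l)
  have "distinct (concat (map f l))"
    using Cons.prems by (intro Cons.IH) auto
  moreover have "set (f x) \<inter> set (f y) = {}" if "y \<in> set l" for y
    using Cons.prems(1) that by (intro Cons.prems(3)) auto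
  ultimately show ?case using Cons.prems(2)[of x] by auto
qed simp

text \<open>A label carries the chain itself and not its number; distinctness therefore rests on
  distinct zeros and distinct chains at each zero.\<close>

lemma distinct_spectral_index:
  assumes "distinct xs" and "\<And>i. i < length xs \<Longrightarrow> distinct (C i)"
  shows "distinct (spectral_index xs C)"
  unfolding spectral_index_def
  by (intro distinct_concat_map)
    (use assms in \<open>auto simp: distinct_map inj_on_def nth_eq_iff_index_eq\<close>)

text \<open>Linear independence speaks of coefficients on a set of vectors; a family indexed by
  \<open>I\<close> is transported to its image through the inverse of the injection
  \<open>h\<close>.\<close>

lemma (in vec_space) lin_indpt_coeff_eq_0:
  assumes "lin_indpt T" and "T \<subseteq> carrier_vec n" and "finite I" and "inj_on h I" and "h ` I \<subseteq> T"
    and "\<And>j. j < n \<Longrightarrow> (\<Sum>i\<in>I. b i * h i $ j) = 0" and "i \<in> I"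
  shows "b i = 0"
proof (rule ccontr)
  assume "b i \<noteq> 0"
  define c where "c x = b (the_inv_into I h x)" for x
  have c: "c (h i) = b i" if "i \<in> I" for i
    using that by (simp add: c_def the_inv_into_f_f[OF assms(4)])
  have sub: "h ` I \<subseteq> carrier_vec n" using assms(2,5) by blast
  have "lincomb c (h ` I) = 0\<^sub>v n"
  proof (rule eq_vecI)
    fix j assume "j < dim_vec (0\<^sub>v n :: 'a vec)"
    then have j: "j < n" by simp
    have "lincomb c (h ` I) $ j = (\<Sum>x\<in>h ` I. c x * x $ j)"
      by (rule lincomb_index[OF j sub])
    also have "\<dots> = (\<Sum>i\<in>I. b i * h i $ j)"
      by (subst sum.reindex[OF assms(4)]) (simp add: c)
    finally show "lincomb c (h ` I) $ j = 0\<^sub>v n $ j" using assms(6) j by simp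
  qed (use lincomb_dim[OF _ sub] assms(3) in simp)
  then have "lin_dep T"
    unfolding lin_dep_def using assms(3,5,7) \<open>b i \<noteq> 0\<close> c
    by (intro exI[of _ "h ` I"] exI[of _ c] exI[of _ "h i"]) auto
  with assms(1) show False by simp
qed

lemma pcompose_root_power: "pcompose ([:- z, 1:] ^ n) [:z, 1:] = monom (1 :: complex) n"
proof -
  have "pcompose [:- z, 1:] [:z, 1:] = monom 1 1"
    by (simp add: pcompose_pCons monom_altdef)
  moreover have "pcompose (f ^ n) g = pcompose f g ^ n" for f g :: "complex poly"
    by (induction n) (simp_all add: pcompose_mult pcompose_1)
  ultimately show ?thesis by (simp add: monom_altdef)
qed

text \<open>
  Test functions vanishing to high order at the other zeros, and to order \<open>k\<^sub>0\<close> at the zero under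
  consideration, where \<open>k\<^sub>0\<close> is the largest index with a nonzero coefficient, isolate the first vectors
  of the chains.
\<close>

lemma spectral_functionals_independent:
  fixes \<beta> :: "complex \<times> complex vec list \<times> nat \<Rightarrow> complex"
  assumes "distinct xs" and "\<And>i. i < length xs \<Longrightarrow> canonical_jordan_chains p P (xs ! i) (C i)"
    and zero: "\<And>f. (\<Sum>t\<in>set (spectral_index xs C). \<beta> t * spectral_functional p t f) = 0"
    and t0: "t0 \<in> set (spectral_index xs C)"
  shows "\<beta> t0 = 0"
proof (rule ccontr)
  define T where "T = set (spectral_index xs C)"
  obtain z v1 k1 where t0_eq: "t0 = (z, v1, k1)" by (cases t0)
  then obtain i where i: "i < length xs" "z = xs ! i" "v1 \<in> set (C i)" "k1 < length v1"
    using t0 by (auto simp: set_spectral_index)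
  have T_z: "(z, v, k) \<in> T \<longleftrightarrow> v \<in> set (C i) \<and> k < length v" for v k
    using i assms(1) by (auto simp: T_def set_spectral_index nth_eq_iff_index_eq)
  assume "\<beta> t0 \<noteq> 0"
  define K where "K = {k. \<exists>v. (z, v, k) \<in> T \<and> \<beta> (z, v, k) \<noteq> 0}"
  define k0 where "k0 = Max K"
  have "K \<subseteq> (snd \<circ> snd) ` T" by (force simp: K_def)
  then have K: "finite K" by (rule finite_subset) (simp add: T_def)
  have "k1 \<in> K" using \<open>\<beta> t0 \<noteq> 0\<close> t0 t0_eq by (auto simp: K_def T_def)
  then have "k0 \<in> K" using Max_in[OF K] by (auto simp: k0_def)
  then obtain v0 where v0: "(z, v0, k0) \<in> T" "\<beta> (z, v0, k0) \<noteq> 0" by (auto simp: K_def)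
  have max: "\<beta> (z, v, k) = 0" if "(z, v, k) \<in> T" "k0 < k" for v k
  proof (rule ccontr)
    assume "\<beta> (z, v, k) \<noteq> 0"
    then have "k \<in> K" using that by (auto simp: K_def)
    then show False using Max_ge[OF K, of k] that(2) by (simp add: k0_def)
  qed
  \<comment> \<open>\<open>D\<close> exceeds all chain indices, so a factor
    \<open>(x - z')^D\<close> makes every functional at \<open>z'\<close> vanish. The polynomial
    \<open>G\<close> collects these factors for the other zeros and is nonzero at
    \<open>z\<close>.\<close>
  define D where "D = Suc (Max ((snd \<circ> snd) ` T))"
  have D: "k < D" if "(z', v, k) \<in> T" for z' v k
  proof -
    have "k \<in> (snd \<circ> snd) ` T" using that by force
    then have "k \<le> Max ((snd \<circ> snd) ` T)" by (intro Max_ge) (auto simp: T_def)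
    then show ?thesis by (simp add: D_def)
  qed
  define G where "G = (\<Prod>z'\<in>set xs - {z}. [:- z', 1:] ^ D)"
  have G_z: "poly G z \<noteq> 0" by (auto simp: G_def poly_prod)
  \<comment> \<open>These are the chains at \<open>z\<close> long enough to have a label with index
    \<open>k0\<close>.\<close>
  define I where "I = {v \<in> set (C i). k0 < length v}"
  have "(\<Sum>v\<in>I. \<beta> (z, v, k0) * (v ! 0) $ a0) = 0" if a0: "a0 < p" for a0
  proof -
    \<comment> \<open>At \<open>z\<close>, functionals of index below \<open>k0\<close> vanish on
      \<open>f\<close>, those of index \<open>k0\<close> give entry \<open>a0\<close> of the first
      chain vector times \<open>G(z)\<close>, and those of larger index have coefficient zero in
      \<beta>.\<close>
    define f where "f = (\<lambda>a. if a = a0 then [:- z, 1:] ^ k0 * G else 0)"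
    have F: "spectral_functional p (z', v, k) f
        = coeff (Poly (map (\<lambda>w. w $ a0) v) * pcompose ([:- z, 1:] ^ k0 * G) [:z', 1:]) k" for z' v k
    proof -
      have "(\<Sum>a<p. Poly (map (\<lambda>w. w $ a) v) * pcompose (f a) [:z', 1:])
          = (\<Sum>a<p. if a = a0 then Poly (map (\<lambda>w. w $ a0) v)
              * pcompose ([:- z, 1:] ^ k0 * G) [:z', 1:] else 0)"
        by (intro sum.cong) (auto simp: f_def)
      then show ?thesis using a0 by (simp add: spectral_functional_def chain_functional_def)
    qed
    have other: "spectral_functional p (z', v, k) f = 0" if t: "(z', v, k) \<in> T" "z' \<noteq> z" for z' v k
    proof -
      have "z' \<in> set xs - {z}" using t by (auto simp: T_def set_spectral_index)
      then have "[:- z', 1:] ^ D dvd [:- z, 1:] ^ k0 * G"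
        unfolding G_def by (intro dvd_mult dvd_prodI[where f = "\<lambda>z'. [:- z', 1:] ^ D"]) auto
      then obtain g where g: "[:- z, 1:] ^ k0 * G = [:- z', 1:] ^ D * g" by (elim dvdE)
      have "spectral_functional p (z', v, k) f
          = coeff (monom 1 D * (Poly (map (\<lambda>w. w $ a0) v) * pcompose g [:z', 1:])) k"
        unfolding F g pcompose_mult pcompose_root_power by (simp only: mult.left_commute)
      then show ?thesis using D[OF t(1)] by (simp add: coeff_monom_mult)
    qed
    have same: "spectral_functional p (z, v, k) f
        = coeff (monom 1 k0 * (Poly (map (\<lambda>w. w $ a0) v) * pcompose G [:z, 1:])) k" for v k
      unfolding F pcompose_mult pcompose_root_power by (simp only: mult.left_commute)
    have top: "spectral_functional p (z, v, k0) f = (v ! 0) $ a0 * poly G z" if "v \<in> I" for v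
    proof -
      have "length v > 0" using that by (auto simp: I_def)
      then have "coeff (Poly (map (\<lambda>w. w $ a0) v)) 0 = (v ! 0) $ a0"
        by (simp add: nth_default_def)
      then show ?thesis
        unfolding same by (subst coeff_monom_mult) (simp add: coeff_mult coeff_pcompose_shift)
    qed
    have "0 = (\<Sum>t\<in>T. \<beta> t * spectral_functional p t f)" using zero by (simp add: T_def)
    also have "\<dots> = (\<Sum>t\<in>(\<lambda>v. (z, v, k0)) ` I. \<beta> t * spectral_functional p t f)"
    proof (rule sum.mono_neutral_right)
      show "\<forall>t\<in>T - (\<lambda>v. (z, v, k0)) ` I. \<beta> t * spectral_functional p t f = 0"
      proof
        fix t assume t: "t \<in> T - (\<lambda>v. (z, v, k0)) ` I"
        obtain z' v k where t_eq: "t = (z', v, k)" by (cases t)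
        show "\<beta> t * spectral_functional p t f = 0"
        proof (cases "z' = z")
          case True
          then have "k \<noteq> k0" using t by (auto simp: t_eq I_def T_z)
          then consider "k < k0" | "k0 < k" by linarith
          then show ?thesis
          proof cases
            case 1
            then show ?thesis
              using same[of v k] by (simp add: t_eq True coeff_monom_mult)
          next
            case 2
            then show ?thesis using max[of v k] t by (simp add: t_eq True)
          qed
        next
          case False
          then show ?thesis using other[of z' v k] t by (simp add: t_eq)
        qed
      qed
      show "(\<lambda>v. (z, v, k0)) ` I \<subseteq> T" by (auto simp: T_z I_def)
    qed (simp add: T_def)
    also have "\<dots> = (\<Sum>v\<in>I. \<beta> (z, v, k0) * (v ! 0) $ a0) * poly G z"
      by (subst sum.reindex) (simp_all add: inj_on_def top sum_distrib_right mult.assoc)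
    finally show ?thesis using G_z by simp
  qed
  note combination = this
  note canonical = assms(2)[OF i(1), unfolded canonical_jordan_chains_def]
  interpret vec_space "TYPE(complex)" p .
  have "lin_indpt (set (map (\<lambda>v. v ! 0) (C i)))" using canonical by simp
  moreover have "set (map (\<lambda>v. v ! 0) (C i)) \<subseteq> carrier_vec p"
    using canonical by (force simp: jordan_chain_def)
  moreover have "finite I" by (simp add: I_def)
  moreover have "inj_on (\<lambda>v. v ! 0) I"
    using canonical by (auto simp: distinct_map I_def intro: inj_on_subset)
  moreover have "(\<lambda>v. v ! 0) ` I \<subseteq> set (map (\<lambda>v. v ! 0) (C i))" by (auto simp: I_def)
  moreover note combination
  moreover have "v0 \<in> I" using v0(1) by (simp add: T_z I_def)
  ultimately have "\<beta> (z, v0, k0) = 0"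
    by (rule lin_indpt_coeff_eq_0[where b = "\<lambda>v. \<beta> (z, v, k0)"])
  with v0(2) show False by simp
qed

text \<open>The vectors \<open>X_stack p k\<close> span all polynomial vectors, so the relation
  extends to every \<open>f\<close>. Distinctness of the labels allows coefficients indexed by
  positions to be read as coefficients of labels.\<close>

lemma spectral_matrix_rows_independent:
  assumes "p > 0" and "distinct xs"
    and "\<And>i. i < length xs \<Longrightarrow> canonical_jordan_chains p P (xs ! i) (C i)"
    and zero: "\<And>k. (\<Sum>m<length (spectral_index xs C).
      \<alpha> m * spectral_functional p (spectral_index xs C ! m) (X_stack p k)) = 0"
    and m0: "m0 < length (spectral_index xs C)"
  shows "\<alpha> m0 = 0"
proof -
  define l where "l = spectral_index xs C"
  have "distinct (C i)" if "i < length xs" for i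
    using assms(3)[OF that] by (auto simp: canonical_jordan_chains_def distinct_map)
  then have l: "distinct l" using distinct_spectral_index[OF assms(2)] by (simp add: l_def)
  define \<beta> where "\<beta> t = \<alpha> (the_inv_into {..<length l} ((!) l) t)" for t
  have inj: "inj_on ((!) l) {..<length l}" using l by (simp add: inj_on_nth)
  have \<beta>: "\<beta> (l ! m) = \<alpha> m" if "m < length l" for m
    using the_inv_into_f_f[OF inj] that by (simp add: \<beta>_def)
  have "(\<Sum>t\<in>set l. \<beta> t * spectral_functional p t f) = 0" for f
  proof -
    \<comment> \<open>\<open>n div p\<close> exceeds the degrees of all components, so the
      coordinates of \<open>f\<close> from \<open>n\<close> on vanish.\<close>
    define n where "n = p * Suc (\<Sum>a<p. degree (f a))"
    have "coeff (f (k mod p)) (k div p) = 0" if "k \<ge> n" for k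
    proof -
      have "degree (f (k mod p)) \<le> (\<Sum>a<p. degree (f a))"
        using assms(1) by (intro member_le_sum) auto
      also have "\<dots> < n div p" using assms(1) by (simp add: n_def)
      also have "\<dots> \<le> k div p" using that by (rule div_le_mono)
      finally show ?thesis by (rule coeff_eq_0)
    qed
    note expansion = X_stack_expansion[OF _ this]
    define c where "c k = coeff (f (k mod p)) (k div p)" for k
    have F: "spectral_functional p t f = (\<Sum>k<n. c k * spectral_functional p t (X_stack p k))" for t
    proof -
      obtain z v k where t: "t = (z, v, k)" by (cases t)
      have "chain_functional p z v k f
          = chain_functional p z v k (\<lambda>a. \<Sum>k<n. Polynomial.smult (c k) (X_stack p k a))"
        unfolding c_def by (rule chain_functional_cong) (rule expansion)
      then show ?thesis by (simp add: t spectral_functional_def chain_functional_sum)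
    qed
    have "set l = (!) l ` {..<length l}"
      by (auto simp: set_conv_nth)
    then have "(\<Sum>t\<in>set l. \<beta> t * spectral_functional p t f)
        = (\<Sum>m<length l. \<alpha> m * spectral_functional p (l ! m) f)"
      by (simp add: sum.reindex[OF inj] \<beta>)
    also have "\<dots> = (\<Sum>k<n. c k * (\<Sum>m<length l. \<alpha> m * spectral_functional p (l ! m) (X_stack p k)))"
      unfolding F sum_distrib_left by (subst sum.swap) (simp add: mult.left_commute)
    also have "\<dots> = 0" using zero by (simp add: l_def)
    finally show ?thesis .
  qed
  then have "\<beta> (l ! m0) = 0"
    using m0 unfolding l_def
    by (intro spectral_functionals_independent[of xs p P C \<beta>, OF assms(2,3)] nth_mem)
  then show ?thesis using \<beta> m0 by (simp add: l_def)
qed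

section \<open>The perturbing matrix polynomial\<close>

lemma coeff_mult_degree_bound:
  fixes f g :: "'a :: comm_ring_1 poly"
  assumes "degree f \<le> m" and "degree g \<le> n"
  shows "coeff (f * g) (m + n) = coeff f m * coeff g n"
proof -
  have "coeff (f * g) (m + n) = (\<Sum>i\<le>m + n. if i = m then coeff f m * coeff g n else 0)"
    unfolding coeff_mult
  proof (intro sum.cong refl)
    fix i
    assume "i \<in> {..m + n}"
    show "coeff f i * coeff g (m + n - i) = (if i = m then coeff f m * coeff g n else 0)"
    proof (cases i m rule: linorder_cases)
      case less
      then have "degree g < m + n - i" using assms(2) by simp
      with less show ?thesis by (simp add: coeff_eq_0)
    next
      case greater
      then have "degree f < i" using assms(1) by simp
      with greater show ?thesis by (simp add: coeff_eq_0)
    qed simp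
  qed
  then show ?thesis by simp
qed

lemma prod_degree_bound:
  fixes f :: "'i \<Rightarrow> 'a :: comm_ring_1 poly"
  assumes "finite I" and "\<And>i. i \<in> I \<Longrightarrow> degree (f i) \<le> b i"
  shows "degree (\<Prod>i\<in>I. f i) \<le> (\<Sum>i\<in>I. b i)"
    and "coeff (\<Prod>i\<in>I. f i) (\<Sum>i\<in>I. b i) = (\<Prod>i\<in>I. coeff (f i) (b i))"
  using assms
proof (induction I)
  case (insert i I)
  {
    case 1
    have "degree (f i * prod f I) \<le> degree (f i) + degree (prod f I)"
      by (rule degree_mult_le)
    also have "\<dots> \<le> b i + sum b I"
      using 1 insert.IH(1) by (intro add_mono) auto
    finally show ?case using insert.hyps by simp
  next
    case 2
    then show ?case using insert.hyps insert.IH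
      by (simp add: coeff_mult_degree_bound)
  }
qed simp_all

text \<open>Each Leibniz term takes one entry from every column, so the column bounds add up, and at
  the total bound only the column-leading coefficients contribute.\<close>

lemma det_column_degree_bound:
  fixes A :: "'a :: comm_ring_1 poly mat"
  assumes A: "A \<in> carrier_mat n n"
    and b: "\<And>i j. i < n \<Longrightarrow> j < n \<Longrightarrow> degree (A $$ (i, j)) \<le> b j"
  shows "degree (det A) \<le> (\<Sum>j<n. b j)"
    and "coeff (det A) (\<Sum>j<n. b j) = det (mat n n (\<lambda>(i, j). coeff (A $$ (i, j)) (b j)))"
proof -
  have sum_b: "(\<Sum>i = 0..<n. b (\<pi> i)) = (\<Sum>j<n. b j)" if "\<pi> permutes {0..<n}" for \<pi>
    using sum.permute[OF that, of b] by (simp add: atLeast0LessThan o_def)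
  have bound: "degree (A $$ (i, \<pi> i)) \<le> b (\<pi> i)"
    if "\<pi> permutes {0..<n}" and "i \<in> {0..<n}" for \<pi> i
    using b[of i "\<pi> i"] permutes_in_image[OF that(1), of i] that(2) by simp
  note prod = prod_degree_bound[of "{0..<n}" "\<lambda>i. A $$ (i, \<pi> i)" "\<lambda>i. b (\<pi> i)" for \<pi>]
  show "degree (det A) \<le> (\<Sum>j<n. b j)"
    unfolding det_def'[OF A]
  proof (intro degree_sum_le)
    fix \<pi> assume "\<pi> \<in> {\<pi>. \<pi> permutes {0..<n}}"
    then show "degree (signof \<pi> * (\<Prod>i = 0..<n. A $$ (i, \<pi> i))) \<le> (\<Sum>j<n. b j)"
      using prod(1)[of \<pi>] bound[of \<pi>] sum_b[of \<pi>] by (simp add: sign_def)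
  qed (simp add: finite_permutations)
  have "coeff (det A) (\<Sum>j<n. b j) = (\<Sum>\<pi> | \<pi> permutes {0..<n}.
      signof \<pi> * (\<Prod>i = 0..<n. coeff (A $$ (i, \<pi> i)) (b (\<pi> i))))"
    unfolding det_def'[OF A] coeff_sum
  proof (intro sum.cong refl)
    fix \<pi> assume "\<pi> \<in> {\<pi>. \<pi> permutes {0..<n}}"
    then show "coeff (signof \<pi> * (\<Prod>i = 0..<n. A $$ (i, \<pi> i))) (\<Sum>j<n. b j) =
        signof \<pi> * (\<Prod>i = 0..<n. coeff (A $$ (i, \<pi> i)) (b (\<pi> i)))"
      using prod(2)[of \<pi>] bound[of \<pi>] sum_b[of \<pi>] by (simp add: sign_def)
  qed
  also have "\<dots> = det (mat n n (\<lambda>(i, j). coeff (A $$ (i, j)) (b j)))"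
    unfolding det_def'[OF mat_carrier]
  proof (intro sum.cong refl)
    fix \<pi> assume "\<pi> \<in> {\<pi>. \<pi> permutes {0..<n}}"
    then have "\<pi> i < n" if "i < n" for i
      using that permutes_in_image[of \<pi> "{0..<n}" i] by simp
    then show "signof \<pi> * (\<Prod>i = 0..<n. coeff (A $$ (i, \<pi> i)) (b (\<pi> i))) =
        signof \<pi> * (\<Prod>i = 0..<n. mat n n (\<lambda>(i, j). coeff (A $$ (i, j)) (b j)) $$ (i, \<pi> i))"
      by simp
  qed
  finally show "coeff (det A) (\<Sum>j<n. b j) = det (mat n n (\<lambda>(i, j). coeff (A $$ (i, j)) (b j)))" .
qed

text \<open>Over the complex numbers the polynomial splits into linear factors. Applied to
  \<open>det P\<close>, this counts the chain functionals.\<close>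

lemma sum_order_roots:
  fixes f :: "complex poly"
  assumes "f \<noteq> 0"
  shows "(\<Sum>z | poly f z = 0. Polynomial.order z f) = degree f"
proof -
  have "degree f = degree (\<Prod>z | poly f z = 0. [:- z, 1:] ^ Polynomial.order z f)"
    using assms by (subst complex_poly_decompose[of f, symmetric]) simp
  also have "\<dots> = (\<Sum>z | poly f z = 0. degree ([:- z, 1:] ^ Polynomial.order z f))"
    by (rule degree_prod_eq_sum_degree) simp
  also have "\<dots> = (\<Sum>z | poly f z = 0. Polynomial.order z f)"
    by (simp add: degree_power_eq)
  finally show ?thesis ..
qed

lemma mult_add_eq_iff:
  fixes p :: nat
  assumes "b < p" and "b' < p"
  shows "a * p + b = a' * p + b' \<longleftrightarrow> a = a' \<and> b = b'"
proof
  assume eq: "a * p + b = a' * p + b'"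
  have "(a * p + b) div p = a" "(a * p + b) mod p = b"
    "(a' * p + b') div p = a'" "(a' * p + b') mod p = b'"
    using assms by auto
  then show "a = a' \<and> b = b'" unfolding eq by simp
qed simp

section \<open>Band structure of multiplication by the perturbation\<close>

lemma coeff_matrix_poly:
  assumes "i < p" and "j < p"
  shows "coeff (matrix_poly p N R $$ (i, j)) k = (if k \<le> N then R k $$ (i, j) else 0)"
  using assms by (simp add: matrix_poly_def coeff_sum)

text \<open>The block form in terms of entries: all of \<open>R N\<close>, and the identity block in
  the lower left corner of \<open>R (N - 1)\<close>.\<close>

locale matrix_perturbation =
  fixes p N r :: nat and R :: "nat \<Rightarrow> complex mat"
  assumes N: "N \<ge> 1" and r: "r < p"
    and R_top: "\<And>i j. i < p \<Longrightarrow> j < p \<Longrightarrow> R N $$ (i, j) = (if r \<le> j \<and> i = j - r then 1 else 0)"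
    and R_next: "\<And>i j. p - r \<le> i \<Longrightarrow> i < p \<Longrightarrow> j < r \<Longrightarrow>
      R (N - 1) $$ (i, j) = (if i = p - r + j then 1 else 0)"
begin

abbreviation P :: "complex poly mat"
  where "P \<equiv> matrix_poly p N R"

abbreviation d :: nat
  where "d \<equiv> N * p - r"

lemma P_carrier: "P \<in> carrier_mat p p"
  by (simp add: matrix_poly_def)

lemma r_le: "r \<le> N * p"
  using N r by (cases N) auto

text \<open>The first \<open>r\<close> columns of \<open>R N\<close> vanish, so the column degrees
  are bounded by \<open>N - 1\<close> and \<open>N\<close>, with sum \<open>d\<close>. The
  coefficient at this bound is the determinant of a matrix with first columns from
  \<open>R (N - 1)\<close> and unit vectors from \<open>R N\<close> as the others.\<close>

lemma degree_det: "degree (det P) = d" and det_nonzero: "det P \<noteq> 0"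
proof -
  define b where "b = (\<lambda>j. if j < r then N - 1 else N)"
  have "degree (P $$ (i, j)) \<le> b j" if "i < p" "j < p" for i j
  proof (rule degree_le, intro allI impI)
    fix k assume "b j < k"
    then show "coeff (P $$ (i, j)) k = 0"
      using that R_top N by (cases "k = N") (auto simp: coeff_matrix_poly b_def split: if_splits)
  qed
  note bound = det_column_degree_bound[OF P_carrier this]
  have sum_b: "(\<Sum>j<p. b j) = d"
  proof -
    have "(\<Sum>j<p. b j) = (\<Sum>j<r. b j) + (\<Sum>j=r..<p. b j)"
      using r by (simp add: sum.atLeastLessThan_concat[of 0 r p, symmetric] atLeast0LessThan[symmetric])
    also have "\<dots> = r * (N - 1) + (p - r) * N"
      by (simp add: b_def)
    also have "\<dots> = d"
    proof -
      obtain e where "p = r + e" using r less_imp_add_positive by blast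
      then show ?thesis using N by (cases N) (auto simp: algebra_simps)
    qed
    finally show ?thesis .
  qed
  define A where "A = mat p p (\<lambda>(i, j). coeff (P $$ (i, j)) (b j))"
  have A: "A $$ (i, j) = (if j < r then R (N - 1) $$ (i, j) else if i = j - r then 1 else 0)"
    if "i < p" "j < p" for i j
    using that R_top by (auto simp: A_def b_def coeff_matrix_poly)
  have "det A \<noteq> 0"
  proof
    assume "det A = 0"
    then obtain v where v: "v \<in> carrier_vec p" "v \<noteq> 0\<^sub>v p" "A *\<^sub>v v = 0\<^sub>v p"
      using det_0_iff_vec_prod_zero[of A p] by (auto simp: A_def)
    have sum: "(\<Sum>j<p. A $$ (i, j) * v $ j) = 0" if "i < p" for i
    proof -
      have "(A *\<^sub>v v) $ i = (\<Sum>j<p. A $$ (i, j) * v $ j)"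
        using that v(1) by (auto simp: A_def scalar_prod_def atLeast0LessThan)
      then show ?thesis using v(3) that by simp
    qed
    \<comment> \<open>The rows from \<open>p - r\<close> on meet the unit columns in zeros and the
      first \<open>r\<close> columns in an identity block, so they isolate the first
      \<open>r\<close> unknowns.\<close>
    have low: "v $ j = 0" if "j < r" for j
    proof -
      have "(\<Sum>l<p. A $$ (p - r + j, l) * v $ l) = (\<Sum>l<p. if l = j then v $ j else 0)"
      proof (intro sum.cong refl)
        fix l assume "l \<in> {..<p}"
        then show "A $$ (p - r + j, l) * v $ l = (if l = j then v $ j else 0)"
          using A[of "p - r + j" l] R_next[of "p - r + j" l] that r by (cases "l < r") auto
      qed
      also have "\<dots> = v $ j" using that r by simp
      finally show ?thesis using sum[of "p - r + j"] that r by simp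
    qed
    have high: "v $ j = 0" if "r \<le> j" "j < p" for j
    proof -
      have "(\<Sum>l<p. A $$ (j - r, l) * v $ l) = (\<Sum>l<p. if l = j then v $ j else 0)"
        using that by (intro sum.cong) (auto simp: A low)
      also have "\<dots> = v $ j" using that by simp
      finally show ?thesis using sum[of "j - r"] that by simp
    qed
    have "v = 0\<^sub>v p"
    proof (rule eq_vecI)
      show "v $ j = 0\<^sub>v p $ j" if "j < dim_vec (0\<^sub>v p :: complex vec)" for j
        using low[of j] high[of j] that by (cases "j < r") auto
    qed (use v(1) in simp)
    with v(2) show False by simp
  qed
  then have "coeff (det P) d \<noteq> 0" "degree (det P) \<le> d"
    using bound sum_b by (simp_all add: A_def)
  then show "degree (det P) = d" "det P \<noteq> 0"
    using le_degree by (auto intro: antisym)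
qed

text \<open>The number \<open>k * p + i\<close> is the basis index of \<open>x^k e_i\<close>. In
  this order the ones of the two identity blocks are the last nonzero coordinates of the columns of
  \<open>P\<close>.\<close>

lemma coeff_P_band:
  assumes "i < p" and "j < p"
  shows "k * p + i > j + d \<Longrightarrow> coeff (P $$ (i, j)) k = 0"
    and "k * p + i = j + d \<Longrightarrow> coeff (P $$ (i, j)) k = 1"
proof -
  obtain N' where N': "N = Suc N'" using N by (cases N) auto
  have small: "k * p + i < N * p" if "k < N" for k
  proof -
    have "Suc k * p \<le> N * p" using that by (intro mult_le_mono1) simp
    then show ?thesis using assms(1) by simp
  qed
  have small': "k * p + i < N' * p" if "k < N'" for k
  proof -
    have "Suc k * p \<le> N' * p" using that by (intro mult_le_mono1) simp
    then show ?thesis using assms(1) by simp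
  qed
  \<comment> \<open>Division of \<open>j + d\<close> by \<open>p\<close> shows which block holds the
    last coordinate: the one in \<open>R N\<close> for \<open>r \<le> j\<close>, the one in
    \<open>R (N - 1)\<close> otherwise.\<close>
  have jd: "j + d = (if r \<le> j then N * p + (j - r) else N' * p + (p - r + j))"
    using r r_le assms by (auto simp: N')
  show "coeff (P $$ (i, j)) k = 0" if "k * p + i > j + d"
  proof (cases "r \<le> j")
    case True
    then have "k \<ge> N" using that small[of k] jd by (cases "k < N") auto
    then show ?thesis using that jd True assms R_top
      by (cases "k = N") (auto simp: coeff_matrix_poly)
  next
    case False
    then have k: "k \<ge> N'" using that small'[of k] jd by (cases "k < N'") auto
    show ?thesis
    proof (cases "k = N'")
      case True
      then show ?thesis using that jd False assms R_next[of i j] by (auto simp: coeff_matrix_poly N')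
    next
      case k': False
      then show ?thesis using k False assms R_top[of i j]
        by (cases "k = N") (auto simp: coeff_matrix_poly N')
    qed
  qed
  show "coeff (P $$ (i, j)) k = 1" if "k * p + i = j + d"
  proof -
    have "k * p + i = (if r \<le> j then N * p + (j - r) else N' * p + (p - r + j))"
      using that jd by simp
    then have "k = (if r \<le> j then N else N')" "i = (if r \<le> j then j - r else p - r + j)"
      using mult_add_eq_iff[of i p "j - r" k N] mult_add_eq_iff[of i p "p - r + j" k N'] assms r
      by (auto split: if_splits)
    then show ?thesis using assms R_top[of i j] R_next[of i j] by (auto simp: coeff_matrix_poly N')
  qed
qed

text \<open>Coordinate \<open>k\<close> of \<open>P X_j\<close>, which is column
  \<open>j mod p\<close> of \<open>P\<close> times \<open>x^(j div p)\<close>.\<close>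

definition mult_coeff :: "complex smat"
  where "mult_coeff k j = coeff (monom 1 (j div p) * P $$ (k mod p, j mod p)) (k div p)"

text \<open>Removing the factor \<open>x^(j div p)\<close> lowers both indices by the same multiple
  of \<open>p\<close>, which reduces the claim to the columns of \<open>P\<close>.\<close>

lemma mult_coeff_band:
  shows "k > j + d \<Longrightarrow> mult_coeff k j = 0" and "mult_coeff (j + d) j = 1"
proof -
  have p: "p > 0" using r by simp
  have *: "(k div p - j div p) * p + k mod p + j div p * p = k" if "j div p \<le> k div p" for k
  proof -
    obtain l where l: "k div p = j div p + l" using \<open>j div p \<le> k div p\<close> le_Suc_ex by blast
    have "k = (j div p + l) * p + k mod p" by (simp add: l[symmetric])
    then show ?thesis by (simp add: l algebra_simps)
  qed
  show "mult_coeff k j = 0" if "k > j + d"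
  proof (cases "j div p \<le> k div p")
    case True
    have "(k div p - j div p) * p + k mod p > j mod p + d"
      using *[OF True] that div_mult_mod_eq[of j p] by linarith
    then show ?thesis using coeff_P_band(1)[of "k mod p" "j mod p"] p
      by (simp add: mult_coeff_def coeff_monom_mult)
  qed (simp add: mult_coeff_def coeff_monom_mult)
  have le: "j div p \<le> (j + d) div p" by (simp add: div_le_mono)
  have "((j + d) div p - j div p) * p + (j + d) mod p = j mod p + d"
    using *[OF le] div_mult_mod_eq[of j p] by linarith
  then show "mult_coeff (j + d) j = 1"
    using coeff_P_band(2)[of "(j + d) mod p" "j mod p"] p le
    by (simp add: mult_coeff_def coeff_monom_mult)
qed

end

section \<open>Perturbed orthogonality\<close>

lemma length_spectral_index:
  "length (spectral_index xs C) = (\<Sum>i<length xs. sum_list (map length (C i)))"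
  by (simp add: spectral_index_def length_concat o_def interv_sum_list_conv_sum_set_nat
      atLeast0LessThan)

text \<open>\<open>Sb^T H^-1\<close> is upper triangular, so column \<open>n\<close> involves only
  the basis vectors up to index \<open>n\<close>.\<close>

lemma A_poly_eq:
  assumes "lower_unitriangular Sb" and "nonsingular_diagonal H" and "a < p"
  shows "A_poly p H Sb n $ a
    = (\<Sum>k<Suc n. Polynomial.smult ((smat_transpose Sb \<star> smat_inverse H) k n) (X_stack p k a))"
proof -
  have "nonsingular_diagonal (smat_inverse H)"
    using assms(2) by (simp add: smat_inverse_diagonal nonsingular_diagonal_def)
  then have zero: "(smat_transpose Sb \<star> smat_inverse H) k n = 0" if "n < k" for k
    using assms(1) that
    by (simp add: times_nonsingular_diagonal smat_transpose_def lower_unitriangular_def)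
  have "A_poly p H Sb n $ a
      = Sum_any (\<lambda>k. Polynomial.smult ((smat_transpose Sb \<star> smat_inverse H) k n) (X_stack p k a))"
    using assms(3) by (simp add: A_poly_def)
  also have "\<dots> = (\<Sum>k<Suc n. Polynomial.smult ((smat_transpose Sb \<star> smat_inverse H) k n) (X_stack p k a))"
  proof (rule Sum_any.expand_superset)
    show "{k. Polynomial.smult ((smat_transpose Sb \<star> smat_inverse H) k n) (X_stack p k a) \<noteq> 0}
        \<subseteq> {..<Suc n}"
      using zero not_less_eq by fastforce
  qed simp
  finally show ?thesis .
qed

context matrix_perturbation
begin

lemma P_times_X_stack:
  assumes "a < p"
  shows "(\<Sum>c<p. P $$ (a, c) * X_stack p j c)
    = (\<Sum>k\<le>j + d. Polynomial.smult (mult_coeff k j) (X_stack p k a))"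
proof -
  have p: "p > 0" using r by simp
  have "monom 1 (j div p) * P $$ (a, j mod p) = (\<Sum>k<Suc (j + d). Polynomial.smult
      (coeff (monom 1 (j div p) * P $$ (k mod p, j mod p)) (k div p)) (X_stack p k a))"
    by (rule X_stack_expansion[OF assms, where f = "\<lambda>a. monom 1 (j div p) * P $$ (a, j mod p)"])
      (use mult_coeff_band(1)[of j] in \<open>simp add: mult_coeff_def\<close>)
  then show ?thesis
    unfolding sum_mult_X_stack[OF p] lessThan_Suc_atMost by (simp only: mult_coeff_def)
qed

text \<open>Linearity of the pairing turns multiplication of the basis vectors by \<open>P\<close>
  into right multiplication of the moment matrix by the band matrix.\<close>

lemma moment_matrix_perturbed_eq_times:
  assumes "matrix_of_measures q p \<Delta> \<nu> W"
  shows "moment_matrix q p \<nu> (perturbed_density W P) = moment_matrix q p \<nu> W \<star> mult_coeff"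
proof (intro ext)
  fix i j
  have "moment_matrix q p \<nu> (perturbed_density W P) i j
      = pairing q p \<nu> W i (\<lambda>a. \<Sum>c<p. P $$ (a, c) * X_stack p j c)"
    by (rule moment_matrix_perturbed[OF assms P_carrier])
  also have "\<dots> = pairing q p \<nu> W i
      (\<lambda>a. \<Sum>k\<le>j + d. Polynomial.smult (mult_coeff k j) (X_stack p k a))"
    by (rule pairing_cong) (rule P_times_X_stack)
  also have "\<dots> = (\<Sum>k\<le>j + d. mult_coeff k j * moment_matrix q p \<nu> W i k)"
    unfolding moment_matrix_eq_pairing by (rule pairing_sum[OF assms])
  also have "\<dots> = (\<Sum>k<Suc (j + d). moment_matrix q p \<nu> W i k * mult_coeff k j)"
    by (simp only: lessThan_Suc_atMost mult.commute)
  also have "\<dots> = (moment_matrix q p \<nu> W \<star> mult_coeff) i j"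
    by (rule smat_times_eq_sum[symmetric]) (simp add: mult_coeff_band(1))
  finally show "moment_matrix q p \<nu> (perturbed_density W P) i j
      = (moment_matrix q p \<nu> W \<star> mult_coeff) i j" .
qed

text \<open>The existence of the factorization is expressed by the leading minors, and the minor of
  size \<open>n\<close> is compared with the \<tau> determinant of the same index.\<close>

lemma perturbed_orthogonality_iff:
  assumes \<mu>: "matrix_of_measures q p \<Delta> \<nu> W"
    and gb: "gauss_borel (moment_matrix q p \<nu> W) S H Sb"
    and xs: "distinct xs" "set xs = {z. poly (det P) z = 0}"
    and C: "\<And>i. i < length xs \<Longrightarrow> canonical_jordan_chains p P (xs ! i) (C i)"
  shows "perturbed_orthogonality_exists q p \<nu> W P \<longleftrightarrow> (\<forall>n. tau d (A_poly p H Sb) xs C n \<noteq> 0)"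
proof -
  define l where "l = spectral_index xs C"
  define F where "F m k = spectral_functional p (l ! m) (X_stack p k)" for m k
  \<comment> \<open>Column \<open>n\<close> of \<open>U\<close> holds the coordinates of
    \<open>A_n\<close> in the basis \<open>X_stack\<close>.\<close>
  define U where "U = smat_transpose Sb \<star> smat_inverse H"
  let ?M = "moment_matrix q p \<nu> W"
  \<comment> \<open>The chain lengths at each zero add up to its multiplicity, so there are as many
    functionals as the degree of \<open>det P\<close>.\<close>
  have length: "length l = d"
  proof -
    have "length l = (\<Sum>i<length xs. Polynomial.order (xs ! i) (det P))"
      using C by (simp add: l_def length_spectral_index canonical_jordan_chains_def)
    also have "\<dots> = (\<Sum>z\<in>set xs. Polynomial.order z (det P))"
      by (rule sum.reindex_bij_betw[OF bij_betw_nth[OF xs(1) refl refl]])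
    finally show ?thesis
      using sum_order_roots[OF det_nonzero] xs(2) by (simp add: degree_det)
  qed
  have chain: "jordan_chain p P z v" if "(z, v, k) \<in> set l" for z v k
    using that C by (auto simp: l_def set_spectral_index canonical_jordan_chains_def)
  have Sb: "lower_unitriangular Sb" and H: "nonsingular_diagonal H"
    using gb by (simp_all add: gauss_borel_def)
  have Hi: "nonsingular_diagonal (smat_inverse H)"
    using H by (simp add: smat_inverse_diagonal nonsingular_diagonal_def)
  have U: "lower_triangular_smat (smat_transpose U)" "U i i \<noteq> 0" for i
    using lower_unitriangularD[OF Sb] nonsingular_diagonalD(2)[OF Hi]
    by (simp_all add: U_def times_nonsingular_diagonal[OF Hi] smat_transpose_def
        lower_triangular_smat_def)
  have MU: "?M \<star> U = (?M \<star> smat_transpose Sb) \<star> smat_inverse H"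
    unfolding U_def
    by (rule smat_times_assoc_upper[symmetric])
      (use lower_unitriangularD(1)[OF Sb] nonsingular_diagonalD(3)[OF Hi] in simp_all)
  have T: "lower_triangular_smat (?M \<star> U)" "(?M \<star> U) i i \<noteq> 0" for i
    using gauss_borel_triangular_entries[OF gb] nonsingular_diagonalD(2)[OF Hi]
    unfolding MU by (simp_all add: times_nonsingular_diagonal[OF Hi] lower_triangular_smat_def)
  \<comment> \<open>Column \<open>j\<close> of \<open>mult_coeff\<close> represents
    \<open>P X_j\<close>, a multiple of \<open>P\<close>, which the chain functionals
    annihilate.\<close>
  have FL: "(\<Sum>k\<le>j + d. F m k * mult_coeff k j) = 0" if "m < d" for m j
  proof -
    obtain z v k where t: "l ! m = (z, v, k)" by (cases "l ! m")
    have mem: "(z, v, k) \<in> set l" using that length t by (metis nth_mem)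
    have "(\<Sum>i\<le>j + d. F m i * mult_coeff i j)
        = chain_functional p z v k (\<lambda>a. \<Sum>i\<le>j + d. Polynomial.smult (mult_coeff i j) (X_stack p i a))"
      by (simp add: chain_functional_sum F_def t spectral_functional_def mult.commute)
    also have "\<dots> = chain_functional p z v k (\<lambda>a. \<Sum>c<p. P $$ (a, c) * X_stack p j c)"
      by (rule chain_functional_cong) (rule P_times_X_stack[symmetric])
    also have "\<dots> = 0"
      by (rule chain_functional_multiple_eq_0[OF chain[OF mem] P_carrier])
        (use mem in \<open>auto simp: l_def set_spectral_index\<close>)
    finally show ?thesis .
  qed
  have F_indep: "\<forall>m<d. \<alpha> m = 0" if "\<And>k. (\<Sum>m<d. \<alpha> m * F m k) = 0" for \<alpha>
  proof (intro allI impI)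
    fix m assume "m < d"
    show "\<alpha> m = 0"
    proof (rule spectral_matrix_rows_independent[where \<alpha> = \<alpha>, OF _ xs(1) C])
      show "(\<Sum>m<length (spectral_index xs C).
          \<alpha> m * spectral_functional p (spectral_index xs C ! m) (X_stack p k)) = 0" for k
        using that[of k] unfolding F_def length[symmetric] unfolding l_def .
    qed (use r \<open>m < d\<close> length in \<open>simp_all add: l_def\<close>)
  qed
  have tau: "tau d (A_poly p H Sb) xs C n = det (mat d d (\<lambda>(m, j). (F \<star> U) m (n + j)))" for n
  proof -
    have carrier: "set v \<subseteq> carrier_vec p" if "i < length xs" "v \<in> set (C i)" for i v
      using C[OF that(1)] that(2) by (auto simp: canonical_jordan_chains_def jordan_chain_def)
    have entries: "concat (map (\<lambda>i. spectral_entries (A_poly p H Sb j) (xs ! i) (C i)) [0..<length xs])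
        = map (\<lambda>t. spectral_functional p t (\<lambda>a. A_poly p H Sb j $ a)) l" for j
      unfolding l_def by (rule concat_spectral_entries) (auto simp: carrier A_poly_def)
    have "spectral_functional p (l ! m) (\<lambda>a. A_poly p H Sb j $ a) = (F \<star> U) m j" for m j
    proof -
      obtain z v k where t: "l ! m = (z, v, k)" by (cases "l ! m")
      have "chain_functional p z v k (\<lambda>a. A_poly p H Sb j $ a) = chain_functional p z v k
          (\<lambda>a. \<Sum>i<Suc j. Polynomial.smult (U i j) (X_stack p i a))"
        unfolding U_def by (rule chain_functional_cong) (rule A_poly_eq[OF Sb H])
      also have "\<dots> = (\<Sum>i<Suc j. F m i * U i j)"
        by (simp only: chain_functional_sum F_def t spectral_functional_def prod.case mult.commute)
      also have "\<dots> = (F \<star> U) m j"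
        by (rule smat_times_upper[OF U(1) lessI, symmetric])
      finally show ?thesis by (simp add: t spectral_functional_def)
    qed
    then show ?thesis
      unfolding tau_def entries
      by (intro arg_cong[of _ _ det] eq_matI) (auto simp: mat_of_cols_def length vec_of_list_index)
  qed
  have "perturbed_orthogonality_exists q p \<nu> W P
      \<longleftrightarrow> (\<forall>n. det (leading_submatrix (?M \<star> mult_coeff) n) \<noteq> 0)"
    unfolding perturbed_orthogonality_exists_def ex_gauss_borel_iff
      moment_matrix_perturbed_eq_times[OF \<mu>] ..
  also have "\<dots> \<longleftrightarrow> (\<forall>n. tau d (A_poly p H Sb) xs C n \<noteq> 0)"
    unfolding tau
    using det_minor_iff_det_spectral[OF U T mult_coeff_band(1) _ FL F_indep]
    by (simp add: mult_coeff_band(2))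
  finally show ?thesis .
qed

end

theorem theorem5p2:
  fixes p q N r :: nat
    and \<Delta> :: "real set" and \<nu> :: "real measure" and W :: "real \<Rightarrow> complex mat"
    and S H Sb :: "complex smat"
    and R :: "nat \<Rightarrow> complex mat" and R1 R2 R4 :: "complex mat"
    and xs :: "complex list" and C :: "nat \<Rightarrow> complex vec list list"
  assumes "p \<ge> 1" and "q \<ge> 1" and "N \<ge> 1" and "r < p"
    and "matrix_of_measures q p \<Delta> \<nu> W"
    and "\<forall>n. det (leading_submatrix (moment_matrix q p \<nu> W) n) \<noteq> 0"
    and "gauss_borel (moment_matrix q p \<nu> W) S H Sb"
    and "\<forall>l\<le>N. R l \<in> carrier_mat p p"
    and "R N = four_block_mat (0\<^sub>m (p - r) r) (1\<^sub>m (p - r)) (0\<^sub>m r r) (0\<^sub>m r (p - r))"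
    and "R1 \<in> carrier_mat (p - r) r" and "R2 \<in> carrier_mat (p - r) (p - r)"
    and "R4 \<in> carrier_mat r (p - r)"
    and "R (N - 1) = four_block_mat R1 R2 (1\<^sub>m r) R4"
    and "distinct xs" and "set xs = {z. poly (det (matrix_poly p N R)) z = 0}"
    and "\<forall>i<length xs. canonical_jordan_chains p (matrix_poly p N R) (xs ! i) (C i)"
  shows "perturbed_orthogonality_exists q p \<nu> W (matrix_poly p N R) \<longleftrightarrow>
    (\<forall>n. tau (N * p - r) (A_poly p H Sb) xs C n \<noteq> 0)"
proof -
  interpret matrix_perturbation p N r R
  proof
    \<comment> \<open>The identity block of \<open>R N\<close> starts in column \<open>r\<close>,
      hence the shift \<open>j - r\<close>.\<close>
    show "R N $$ (i, j) = (if r \<le> j \<and> i = j - r then 1 else 0)" if "i < p" "j < p" for i j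
      using that assms(4) by (auto simp: assms(9))
    show "R (N - 1) $$ (i, j) = (if i = p - r + j then 1 else 0)"
      if "p - r \<le> i" "i < p" "j < r" for i j
      using that assms(4,10-12) by (subst assms(13)) auto
  qed fact+
  show ?thesis
    using assms(16) by (intro perturbed_orthogonality_iff[OF assms(5,7,14,15)]) auto
qed

end
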